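(* Let $0<\alpha<1$, let $\gamma_1,\gamma_2$ be real constants with $\gamma_1^2+\gamma_2^2\neq 0$, and let $\varphi_1,\varphi_2,\psi$ and $Q(x,t)$ be given functions with $\varphi_1(0)=\psi(0)$. Suppose that $\gamma_2\ge 0$, that $\frac{\partial}{\partial t}Q(x,t)=-Q_1(x)Q_1(t)$ for some function $Q_1$ of one variable, and that $Q(x,x)>0$. If there exists a solution to the Problem (defined in the context) with data $\varphi_1,\varphi_2,\psi,Q,\gamma_1,\gamma_2$, then it is unique.
   Context: All functions are real-valued. Domains: $\Omega^+=\{(x,y):0<x<1,\ 0<y<1\}$, $\Omega^-=\{(x,y):-y<x<y+1,\ -1/2<y<0\}$, $AB=\{(x,y):0<x<1,\ y=0\}$, $\Omega=\Omega^+\cup\Omega^-\cup AB$. The functions $\varphi_1,\varphi_2$ are defined on $[0,1]$, $\psi$ on $[0,1/2]$, and $Q$ on $[0,1]\times[0,1]$. For $0<\alpha<1$ the Caputo fractional derivative of order $\alpha$ is $${}_{C}D_{0y}^{\alpha}f=\frac{1}{\Gamma(1-\alpha)}\int_0^y (y-t)^{-\alpha}f'(t)\,dt,$$ where $\Gamma$ is Euler's gamma function; for a function $u(x,y)$ it is applied in the variable $y$ with $x$ fixed. Class of functions: $$W=\{u(x,y):\ u\in C(\overline{\Omega})\cap C^2(\Omega^-),\ u_{xx}\in C(\Omega^+),\ {}_{C}D_{0y}^{\alpha}u\in C(\Omega^+)\}.$$ Problem. Find $u\in W$ satisfying the equation $$u_{xx}-{}_{C}D_{0y}^{\alpha}u=0\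 \text{ in }\Omega^+\ (y>0),\qquad u_{xx}-u_{yy}=0\ \text{ in }\Omega^-\ (y<0),$$ the boundary conditions $$u(0,y)=\varphi_1(y),\quad u(1,y)=\varphi_2(y)\quad (0\le y\le 1),\qquad u(x,-x)=\psi(x)\quad (0\le x\le 1/2),$$ and the gluing condition $$\lim_{y\to+0}y^{1-\alpha}u_y(x,y)=\gamma_1u_y(x,-0)+\gamma_2\int_0^x u_y(t,-0)Q(x,t)\,dt,\qquad 0<x<1,$$ where $u_y(x,-0)=\lim_{y\to-0}u_y(x,y)$ (the limits and the integral appearing here being required to exist). *)

theory Defs
  imports "HOL-Analysis.Analysis"
begin

definition Omega_plus :: "(real \<times> real) set" where
  "Omega_plus = {(x, y). 0 < x \<and> x < 1 \<and> 0 < y \<and> y < 1}"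

definition Omega_minus :: "(real \<times> real) set" where
  "Omega_minus = {(x, y). - y < x \<and> x < y + 1 \<and> - (1/2) < y \<and> y < 0}"

definition seg_AB :: "(real \<times> real) set" where
  "seg_AB = {(x, y). 0 < x \<and> x < 1 \<and> y = 0}"

definition Omega :: "(real \<times> real) set" where
  "Omega = Omega_plus \<union> Omega_minus \<union> seg_AB"

text \<open>
  Functions on the plane are total; only their values on the closure of \<open>Omega\<close> matter.
  The partial derivatives below are meaningful only where the corresponding
  differentiability predicate holds; they are used only at points of the open sets
  \<open>Omega_plus\<close> and \<open>Omega_minus\<close>, where they are independent of the values outside.
\<close>

definition diff_x_at :: "(real \<times> real \<Rightarrow> real) \<Rightarrow> real \<times> real \<Rightarrow> bool" where
  "diff_x_at u p \<longleftrightarrow> (\<lambda>s. u (s, snd p)) differentiable at (fst p)"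

definition diff_y_at :: "(real \<times> real \<Rightarrow> real) \<Rightarrow> real \<times> real \<Rightarrow> bool" where
  "diff_y_at u p \<longleftrightarrow> (\<lambda>s. u (fst p, s)) differentiable at (snd p)"

definition partial_x :: "(real \<times> real \<Rightarrow> real) \<Rightarrow> real \<times> real \<Rightarrow> real" where
  "partial_x u p = deriv (\<lambda>s. u (s, snd p)) (fst p)"

definition partial_y :: "(real \<times> real \<Rightarrow> real) \<Rightarrow> real \<times> real \<Rightarrow> real" where
  "partial_y u p = deriv (\<lambda>s. u (fst p, s)) (snd p)"

text \<open>Meant for open \<open>S\<close>: continuous first (and second) order partial derivatives on \<open>S\<close>.\<close>

definition C1_on :: "(real \<times> real \<Rightarrow> real) \<Rightarrow> (real \<times> real) set \<Rightarrow> bool" where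
  "C1_on u S \<longleftrightarrow>
     (\<forall>p\<in>S. diff_x_at u p \<and> diff_y_at u p) \<and>
     continuous_on S (partial_x u) \<and> continuous_on S (partial_y u)"

definition C2_on :: "(real \<times> real \<Rightarrow> real) \<Rightarrow> (real \<times> real) set \<Rightarrow> bool" where
  "C2_on u S \<longleftrightarrow> C1_on u S \<and> C1_on (partial_x u) S \<and> C1_on (partial_y u) S"

text \<open>
  The integrals are Henstock--Kurzweil integrals, so that both Lebesgue integrals and
  convergent improper integrals are covered. The endpoints of the interval of integration
  (where the kernel is singular, and where \<open>deriv f\<close> need not make sense) form a null set.
\<close>

definition caputo :: "real \<Rightarrow> (real \<Rightarrow> real) \<Rightarrow> real \<Rightarrow> real" where
  "caputo \<alpha> f y =
     1 / Gamma (1 - \<alpha>) * integral {0..y} (\<lambda>t. (y - t) powr (- \<alpha>) * deriv f t)"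

definition caputo_exists :: "real \<Rightarrow> (real \<Rightarrow> real) \<Rightarrow> real \<Rightarrow> bool" where
  "caputo_exists \<alpha> f y \<longleftrightarrow>
     (\<forall>t. 0 < t \<and> t < y \<longrightarrow> f differentiable at t) \<and>
     (\<lambda>t. (y - t) powr (- \<alpha>) * deriv f t) integrable_on {0..y}"

definition class_W :: "real \<Rightarrow> (real \<times> real \<Rightarrow> real) set" where
  "class_W \<alpha> = {u.
     continuous_on (closure Omega) u \<and>
     C2_on u Omega_minus \<and>
     (\<forall>p\<in>Omega_plus. diff_x_at u p \<and> diff_x_at (partial_x u) p) \<and>
     continuous_on Omega_plus (partial_x (partial_x u)) \<and>
     (\<forall>(x, y)\<in>Omega_plus. caputo_exists \<alpha> (\<lambda>t. u (x, t)) y) \<and>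
     continuous_on Omega_plus (\<lambda>(x, y). caputo \<alpha> (\<lambda>t. u (x, t)) y)}"

text \<open>The one-sided limit \<open>u_y(x, -0)\<close>; its existence is demanded in \<open>gluing\<close>.\<close>

definition uy_minus :: "(real \<times> real \<Rightarrow> real) \<Rightarrow> real \<Rightarrow> real" where
  "uy_minus u x = Lim (at_left 0) (\<lambda>y. partial_y u (x, y))"

definition gluing ::
  "real \<Rightarrow> real \<Rightarrow> real \<Rightarrow> (real \<Rightarrow> real \<Rightarrow> real) \<Rightarrow> (real \<times> real \<Rightarrow> real) \<Rightarrow> bool" where
  "gluing \<alpha> \<gamma>\<^sub>1 \<gamma>\<^sub>2 Q u \<longleftrightarrow>
     (\<forall>x. 0 < x \<and> x < 1 \<longrightarrow>
        ((\<lambda>y. partial_y u (x, y)) \<longlongrightarrow> uy_minus u x) (at_left 0) \<and>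
        (\<lambda>t. uy_minus u t * Q x t) integrable_on {0..x} \<and>
        ((\<lambda>y. y powr (1 - \<alpha>) * partial_y u (x, y)) \<longlongrightarrow>
           \<gamma>\<^sub>1 * uy_minus u x + \<gamma>\<^sub>2 * integral {0..x} (\<lambda>t. uy_minus u t * Q x t)) (at_right 0))"

definition is_solution ::
  "real \<Rightarrow> real \<Rightarrow> real \<Rightarrow> (real \<Rightarrow> real) \<Rightarrow> (real \<Rightarrow> real) \<Rightarrow> (real \<Rightarrow> real) \<Rightarrow>
     (real \<Rightarrow> real \<Rightarrow> real) \<Rightarrow> (real \<times> real \<Rightarrow> real) \<Rightarrow> bool" where
  "is_solution \<alpha> \<gamma>\<^sub>1 \<gamma>\<^sub>2 \<phi>\<^sub>1 \<phi>\<^sub>2 \<psi> Q u \<longleftrightarrow>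
     u \<in> class_W \<alpha> \<and>
     (\<forall>(x, y)\<in>Omega_plus.
        partial_x (partial_x u) (x, y) - caputo \<alpha> (\<lambda>t. u (x, t)) y = 0) \<and>
     (\<forall>(x, y)\<in>Omega_minus.
        partial_x (partial_x u) (x, y) - partial_y (partial_y u) (x, y) = 0) \<and>
     (\<forall>y\<in>{0..1}. u (0, y) = \<phi>\<^sub>1 y) \<and>
     (\<forall>y\<in>{0..1}. u (1, y) = \<phi>\<^sub>2 y) \<and>
     (\<forall>x\<in>{0..1/2}. u (x, - x) = \<psi> x) \<and>
     gluing \<alpha> \<gamma>\<^sub>1 \<gamma>\<^sub>2 Q u"

end

theory Submission
  imports Defs
begin

text \<open>
  Let \<open>u\<close> and \<open>v\<close> be two solutions, \<open>w = v - u\<close> and \<open>\<tau> x = w (x, 0)\<close>. Everything reduces to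
  \<open>\<tau> = 0\<close>: then \<open>w\<close> vanishes in the triangle because it is determined there by \<open>\<tau>\<close>, and in
  the square by the maximum principle.

  In the triangle, d'Alembert's formula (\<open>dAlembert_representation\<close>) and the common data on the
  left characteristic give \<open>w (x, y) = \<tau> (x + y)\<close>, so that \<open>\<tau>\<close> is twice differentiable and
  \<open>w\<^sub>y (x, -0) = \<tau>' x\<close>. The gluing condition thus says that \<open>y\<^bsup>1 - \<alpha>\<^esup> w\<^sub>y\<close> tends, for \<open>y \<rightarrow> +0\<close>, to
  \<open>\<nu> x = \<gamma>\<^sub>1 \<tau>' x + \<gamma>\<^sub>2 \<integral>\<^sub>0\<^sup>x \<tau>' t Q x t dt\<close>.

  In the square, one would like to let \<open>y \<rightarrow> 0\<close> in \<open>w\<^sub>x\<^sub>x = D\<^bsup>\<alpha>\<^esup> w\<close> and read off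
  \<open>\<tau>'' = \<Gamma> \<alpha> * \<nu>\<close>. However \<open>w\<^sub>x\<^sub>x\<close> is only known to be continuous in the open square, and
  pointwise convergence of \<open>w\<^sub>x\<^sub>x\<close> together with uniform convergence of \<open>w\<close> does not determine
  the limit of \<open>w\<^sub>x\<^sub>x\<close>. The maximum principle replaces the limit: near \<open>x0\<close> the solution is
  enclosed between the explicit solutions
  \<open>\<tau> x0 + \<tau>' x0 (x - x0) + c (x - x0)\<^sup>2 / 2 + c y\<^bsup>\<alpha>\<^esup> / \<Gamma> (1 + \<alpha>)\<close> with \<open>c\<close> slightly above and
  slightly below \<open>\<tau>'' x0\<close>. Hence \<open>(w (x0, y) - \<tau> x0) / y\<^bsup>\<alpha>\<^esup> \<rightarrow> \<tau>'' x0 / \<Gamma> (1 + \<alpha>)\<close>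
  (\<open>frac_heat_initial_rate\<close>), while l'Hopital's rule evaluates the same limit as \<open>\<nu> x0 / \<alpha>\<close>.

  Finally, the form of \<open>Q\<close> allows an integration by parts:
  \<open>\<integral>\<^sub>0\<^sup>x \<tau>' t Q x t dt = Q x x * \<tau> x + Q\<^sub>1 x * G x\<close> with \<open>G' = \<tau> Q\<^sub>1\<close>, \<open>G 0 = 0\<close>
  (\<open>kernel_splitting\<close>). Multiplying \<open>\<tau>'' = \<Gamma> \<alpha> * \<nu>\<close> by \<open>\<tau>\<close> turns the last product into
  \<open>(G\<^sup>2)' / 2\<close> and the first-order term into \<open>(\<tau>\<^sup>2)' / 2\<close>; as \<open>\<tau>\<close> vanishes at both ends,
  what is left is a sum of nonnegative terms
  (\<open>nonlocal_problem_trivial\<close>).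
\<close>

section \<open>Comparison principle for the time-fractional diffusion equation\<close>

text \<open>
  Integrating by parts, with \<open>f t - f y \<le> 0\<close> as antiderivative of \<open>f' t\<close>, leaves an integrand of
  one sign, because the kernel increases up to the singularity. The boundary term at \<open>t = y\<close>
  disappears since \<open>f\<close> is differentiable at \<open>y\<close> and \<open>\<alpha> < 1\<close>. This is the fractional substitute for
  the vanishing of the time derivative at a maximum: the whole past contributes, and the bound
  is positive as soon as \<open>f 0 < f y\<close>.
\<close>

lemma caputo_integral_ge_at_max:
  fixes f f' :: "real \<Rightarrow> real"
  assumes "0 < \<alpha>" "\<alpha> < 1" "0 < y"
    and cont: "continuous_on {0..y} f"
    and der: "\<And>t. 0 < t \<Longrightarrow> t \<le> y \<Longrightarrow> (f has_real_derivative f' t) (at t)"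
    and int: "((\<lambda>t. (y - t) powr (-\<alpha>) * f' t) has_integral I) {0..y}"
    and max: "\<And>t. 0 \<le> t \<Longrightarrow> t \<le> y \<Longrightarrow> f t \<le> f y"
  shows "y powr (-\<alpha>) * (f y - f 0) \<le> I"
proof -
  let ?k = "\<lambda>t. (y - t) powr (-\<alpha>)"
  let ?k' = "\<lambda>t. \<alpha> * (y - t) powr (-\<alpha> - 1)"
  let ?J = "\<lambda>z. integral {0..z} (\<lambda>t. ?k t * f' t)"
  \<comment> \<open>The kernel is smooth away from \<open>y\<close>, so the integration by parts is first carried out up to \<open>z < y\<close>.\<close>
  have ge: "?k 0 * (f y - f 0) - ?k z * (f y - f z) \<le> ?J z" if z: "0 < z" "z < y" for z
  proof -
    have cf: "continuous_on {0..z} f"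
      by (rule continuous_on_subset[OF cont]) (use z in auto)
    have parts: "((\<lambda>t. ?k' t * (f t - f y) + ?k t * f' t) has_integral
        ?k z * (f z - f y) - ?k 0 * (f 0 - f y)) {0..z}"
    proof (rule fundamental_theorem_of_calculus_interior)
      show "continuous_on {0..z} (\<lambda>t. ?k t * (f t - f y))"
        by (intro continuous_intros cf) (use z in auto)
      show "((\<lambda>t. ?k t * (f t - f y)) has_vector_derivative
          ?k' t * (f t - f y) + ?k t * f' t) (at t)" if "t \<in> {0<..<z}" for t
        unfolding has_real_derivative_iff_has_vector_derivative[symmetric]
        by (rule derivative_eq_intros der refl | use that z in simp)+
    qed (use z in auto)
    have "(\<lambda>t. ?k' t * (f t - f y)) integrable_on {0..z}"
      by (rule integrable_continuous_interval) (intro continuous_intros cf; use z in auto)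
    then obtain K where K: "((\<lambda>t. ?k' t * (f t - f y)) has_integral K) {0..z}"
      by blast
    have "K \<le> 0"
      by (rule has_integral_le[OF K has_integral_0])
         (use assms z in \<open>auto intro!: mult_nonneg_nonpos max simp: less_imp_le\<close>)
    moreover have "((\<lambda>t. ?k t * f' t) has_integral
        (?k z * (f z - f y) - ?k 0 * (f 0 - f y)) - K) {0..z}"
      using has_integral_diff[OF parts K] by simp
    hence "?J z = (?k z * (f z - f y) - ?k 0 * (f 0 - f y)) - K"
      by (rule integral_unique)
    ultimately show ?thesis
      by (simp add: algebra_simps)
  qed
  have "continuous_on {0..y} ?J"
    by (rule indefinite_integral_continuous_1) (use int in blast)
  hence "(?J \<longlongrightarrow> ?J y) (at y within {0..y})"
    using \<open>0 < y\<close> by (simp add: continuous_on)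
  hence J: "(?J \<longlongrightarrow> I) (at_left y)"
    using int \<open>0 < y\<close> by (simp add: at_within_Icc_at_left integral_unique)
  \<comment> \<open>The boundary term at \<open>z\<close> is a difference quotient times \<open>(y - z)\<close> to the power \<open>1 - \<alpha> > 0\<close>.\<close>
  have "((\<lambda>z. (f z - f y) / (z - y)) \<longlongrightarrow> f' y) (at_left y)"
    using der[of y] \<open>0 < y\<close> unfolding has_field_derivative_iff
    by (auto intro: filterlim_at_within_not_equal tendsto_mono[OF at_le])
  moreover have "((\<lambda>z. (y - z) powr (1 - \<alpha>)) \<longlongrightarrow> 0) (at_left y)"
  proof -
    have "((\<lambda>z. (y - z) powr (1 - \<alpha>)) \<longlongrightarrow> (y - y) powr (1 - \<alpha>)) (at_left y)"
      by (intro tendsto_intros) (use \<open>\<alpha> < 1\<close> in \<open>auto simp: eventually_at_filter\<close>)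
    thus ?thesis by simp
  qed
  ultimately have "((\<lambda>z. (y - z) powr (1 - \<alpha>) * ((f z - f y) / (z - y))) \<longlongrightarrow> 0 * f' y) (at_left y)"
    by (intro tendsto_intros)
  moreover have "\<forall>\<^sub>F z in at_left y. (y - z) powr (1 - \<alpha>) * ((f z - f y) / (z - y)) = ?k z * (f y - f z)"
    unfolding eventually_at_filter
  proof (rule always_eventually, intro allI impI)
    fix z assume "z \<noteq> y" "z \<in> {..<y}"
    thus "(y - z) powr (1 - \<alpha>) * ((f z - f y) / (z - y)) = ?k z * (f y - f z)"
      by (simp add: powr_diff powr_minus field_simps)
  qed
  ultimately have "((\<lambda>z. ?k z * (f y - f z)) \<longlongrightarrow> 0) (at_left y)"
    using Lim_transform_eventually by fastforce
  hence "((\<lambda>z. ?k 0 * (f y - f 0) - ?k z * (f y - f z)) \<longlongrightarrow> ?k 0 * (f y - f 0) - 0) (at_left y)"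
    by (intro tendsto_intros)
  moreover have "\<forall>\<^sub>F z in at_left y. ?k 0 * (f y - f 0) - ?k z * (f y - f z) \<le> ?J z"
    using eventually_at_left_real[OF \<open>0 < y\<close>] by eventually_elim (use ge in auto)
  ultimately show ?thesis
    using tendsto_le[OF trivial_limit_at_left_real J] by simp
qed

lemma second_derivative_nonpos_at_max:
  fixes f f' :: "real \<Rightarrow> real"
  assumes ab: "a < x" "x < b"
    and d1: "\<And>s. a < s \<Longrightarrow> s < b \<Longrightarrow> (f has_real_derivative f' s) (at s)"
    and d2: "(f' has_real_derivative l) (at x)"
    and max: "\<And>s. a < s \<Longrightarrow> s < b \<Longrightarrow> f s \<le> f x"
  shows "l \<le> 0"
proof (rule ccontr)
  assume "\<not> l \<le> 0"
  have "f' x = 0"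
    by (rule DERIV_local_max[OF d1[OF ab], of "min (x - a) (b - x)"]) (use ab max in auto)
  obtain d where d: "d > 0" "\<And>h. h > 0 \<Longrightarrow> h < d \<Longrightarrow> f' x < f' (x + h)"
    using DERIV_pos_inc_right[OF d2] \<open>\<not> l \<le> 0\<close> by auto
  define z where "z = x + min d (b - x) / 2"
  have z: "x < z" "z < b" "z < x + d"
    using ab d by (auto simp: z_def min_def field_simps)
  obtain s where s: "x < s" "s < z" "f z - f x = (z - x) * f' s"
    using MVT2[of x z f f'] d1 ab z by auto
  have "f' s > 0" using d(2)[of "s - x"] s z \<open>f' x = 0\<close> by auto
  hence "f z > f x" using s z by (smt (verit) mult_pos_pos)
  thus False using max[of z] ab z by auto
qed

text \<open>
  The equation \<open>w\<^sub>x\<^sub>x = D\<^bsup>\<alpha>\<^esup> w\<close> on the open rectangle \<open>(a, b) \<times> (0, T)\<close>, where \<open>D\<^bsup>\<alpha>\<^esup>\<close> always starts at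
  \<open>y = 0\<close>. The derivatives are explicit functions and the Caputo derivative is a
  \<open>has_integral\<close> statement, multiplied through by \<open>\<Gamma> (1 - \<alpha>)\<close>; existence and value are then one
  condition, which passes to differences term by term.
\<close>

definition frac_heat_derivs where
  "frac_heat_derivs \<alpha> a b T (w :: real \<Rightarrow> real \<Rightarrow> real) wx wxx wy \<longleftrightarrow>
     (\<forall>x y. a < x \<and> x < b \<and> 0 < y \<and> y < T \<longrightarrow>
        ((\<lambda>s. w s y) has_real_derivative wx x y) (at x) \<and>
        ((\<lambda>s. wx s y) has_real_derivative wxx x y) (at x) \<and>
        ((\<lambda>t. w x t) has_real_derivative wy x y) (at y) \<and>
        ((\<lambda>t. (y - t) powr (-\<alpha>) * wy x t) has_integral Gamma (1 - \<alpha>) * wxx x y) {0..y})"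

definition frac_heat :: "real \<Rightarrow> real \<Rightarrow> real \<Rightarrow> real \<Rightarrow> (real \<Rightarrow> real \<Rightarrow> real) \<Rightarrow> bool" where
  "frac_heat \<alpha> a b T w \<longleftrightarrow> (\<exists>wx wxx wy. frac_heat_derivs \<alpha> a b T w wx wxx wy)"

lemma frac_heat_derivsD:
  assumes "frac_heat_derivs \<alpha> a b T w wx wxx wy" "a < x" "x < b" "0 < y" "y < T"
  shows "((\<lambda>s. w s y) has_real_derivative wx x y) (at x)"
    and "((\<lambda>s. wx s y) has_real_derivative wxx x y) (at x)"
    and "((\<lambda>t. w x t) has_real_derivative wy x y) (at y)"
    and "((\<lambda>t. (y - t) powr (-\<alpha>) * wy x t) has_integral Gamma (1 - \<alpha>) * wxx x y) {0..y}"
  using assms unfolding frac_heat_derivs_def by auto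

lemma frac_heat_diff:
  assumes "frac_heat \<alpha> a b T u" "frac_heat \<alpha> a b T v"
  shows "frac_heat \<alpha> a b T (\<lambda>x y. u x y - v x y)"
proof -
  obtain ux uxx uy vx vxx vy
    where u: "frac_heat_derivs \<alpha> a b T u ux uxx uy" and v: "frac_heat_derivs \<alpha> a b T v vx vxx vy"
    using assms unfolding frac_heat_def by blast
  have "frac_heat_derivs \<alpha> a b T (\<lambda>x y. u x y - v x y) (\<lambda>x y. ux x y - vx x y)
      (\<lambda>x y. uxx x y - vxx x y) (\<lambda>x y. uy x y - vy x y)"
    unfolding frac_heat_derivs_def right_diff_distrib
    by (intro allI impI conjI DERIV_diff has_integral_diff frac_heat_derivsD[OF u] frac_heat_derivsD[OF v]; simp)
  thus ?thesis unfolding frac_heat_def by blast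
qed

lemma frac_heat_subset:
  assumes "frac_heat \<alpha> a b T u" "a \<le> a'" "b' \<le> b" "T' \<le> T"
  shows "frac_heat \<alpha> a' b' T' u"
proof -
  have sub: "a < x \<and> x < b \<and> 0 < y \<and> y < T" if "a' < x \<and> x < b' \<and> 0 < y \<and> y < T'" for x y
    using that assms by auto
  show ?thesis
    using assms(1) unfolding frac_heat_def frac_heat_derivs_def
    by (elim ex_forward all_forward) (use sub in blast)
qed

text \<open>
  At a positive maximum \<open>(p, q)\<close> off the bottom and the sides, \<open>w\<^sub>x\<^sub>x \<le> 0\<close>, whereas
  \<open>caputo_integral_ge_at_max\<close> makes the Caputo derivative strictly positive because
  \<open>w p 0 \<le> 0 < w p q\<close>. As \<open>D\<^bsup>\<alpha>\<^esup>\<close> only looks into the past, this covers a maximum on the top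
  edge \<open>y = T'\<close>, where the equation holds because of \<open>T' < T\<close>.
\<close>

lemma frac_heat_comparison:
  fixes w :: "real \<Rightarrow> real \<Rightarrow> real"
  assumes \<alpha>: "0 < \<alpha>" "\<alpha> < 1"
    and w: "frac_heat \<alpha> a b T w" and T': "T' < T"
    and cont: "continuous_on ({a..b} \<times> {0..T'}) (\<lambda>(x, y). w x y)"
    and bottom: "\<And>x. a \<le> x \<Longrightarrow> x \<le> b \<Longrightarrow> w x 0 \<le> 0"
    and left: "\<And>y. 0 \<le> y \<Longrightarrow> y \<le> T' \<Longrightarrow> w a y \<le> 0"
    and right: "\<And>y. 0 \<le> y \<Longrightarrow> y \<le> T' \<Longrightarrow> w b y \<le> 0"
    and xy: "a \<le> x" "x \<le> b" "0 \<le> y" "y \<le> T'"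
  shows "w x y \<le> 0"
proof -
  have "compact ({a..b} \<times> {0..T'})" "{a..b} \<times> {0..T'} \<noteq> {}"
    using xy by (auto intro: compact_Times)
  from continuous_attains_sup[OF this cont]
  obtain p q where pq: "a \<le> p" "p \<le> b" "0 \<le> q" "q \<le> T'"
    and "\<forall>z\<in>{a..b} \<times> {0..T'}. (case z of (x, y) \<Rightarrow> w x y) \<le> w p q"
    by force
  hence max: "\<And>x y. a \<le> x \<Longrightarrow> x \<le> b \<Longrightarrow> 0 \<le> y \<Longrightarrow> y \<le> T' \<Longrightarrow> w x y \<le> w p q"
    by auto
  have "w p q \<le> 0"
  proof (rule ccontr)
    assume pos: "\<not> w p q \<le> 0"
    hence in_pq: "a < p" "p < b" "0 < q"
      using bottom[of p] left[of q] right[of q] pq by (auto simp: less_le)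
    obtain wx wxx wy where d: "frac_heat_derivs \<alpha> a b T w wx wxx wy"
      using w unfolding frac_heat_def by blast
    have "q < T" using pq T' by simp
    have "wxx p q \<le> 0"
    proof (rule second_derivative_nonpos_at_max[of a p b "\<lambda>s. w s q" "\<lambda>s. wx s q"])
      show "w s q \<le> w p q" if "a < s" "s < b" for s
        using that pq by (intro max) auto
      show "((\<lambda>s. w s q) has_real_derivative wx s q) (at s)" if "a < s" "s < b" for s
        using that in_pq \<open>q < T\<close> by (intro frac_heat_derivsD(1)[OF d])
      show "((\<lambda>s. wx s q) has_real_derivative wxx p q) (at p)"
        using in_pq \<open>q < T\<close> by (intro frac_heat_derivsD(2)[OF d])
    qed (fact in_pq)+
    moreover have "q powr (-\<alpha>) * (w p q - w p 0) \<le> Gamma (1 - \<alpha>) * wxx p q"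
    proof (rule caputo_integral_ge_at_max[OF \<alpha> \<open>0 < q\<close>])
      have "continuous_on {0..q} ((\<lambda>(x, y). w x y) \<circ> (\<lambda>t. (p, t)))"
        by (intro continuous_on_compose continuous_intros continuous_on_subset[OF cont])
           (use in_pq pq in auto)
      thus "continuous_on {0..q} (\<lambda>t. w p t)" by (simp add: o_def)
      show "((\<lambda>t. w p t) has_real_derivative wy p t) (at t)" if "0 < t" "t \<le> q" for t
        using that in_pq \<open>q < T\<close> by (intro frac_heat_derivsD(3)[OF d]) auto
      show "((\<lambda>t. (q - t) powr (-\<alpha>) * wy p t) has_integral Gamma (1 - \<alpha>) * wxx p q) {0..q}"
        using in_pq \<open>q < T\<close> by (intro frac_heat_derivsD(4)[OF d]) auto
      show "w p t \<le> w p q" if "0 \<le> t" "t \<le> q" for t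
        using that pq by (intro max) auto
    qed
    moreover have "q powr (-\<alpha>) * (w p q - w p 0) > 0"
      using in_pq pos bottom[of p] by (intro mult_pos_pos) auto
    moreover have "Gamma (1 - \<alpha>) * wxx p q \<le> 0"
      using \<alpha> \<open>wxx p q \<le> 0\<close> by (intro mult_nonneg_nonpos) (auto simp: less_imp_le)
    ultimately show False by linarith
  qed
  thus ?thesis using max[OF xy] by simp
qed

section \<open>Growth of solutions at the initial line\<close>

text \<open>
  The substitution \<open>t = y s\<close> turns this into the Beta integral \<open>B(\<alpha>, 1 - \<alpha>)\<close>: the powers of \<open>y\<close>
  cancel, so that the Caputo derivative of \<open>y\<^bsup>\<alpha>\<^esup>\<close> is constant.
\<close>

lemma caputo_integral_powr:
  fixes \<alpha> y :: real
  assumes "0 < \<alpha>" "\<alpha> < 1" "0 < y"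
  shows "((\<lambda>t. (y - t) powr (-\<alpha>) * (\<alpha> * t powr (\<alpha> - 1))) has_integral
           Gamma (1 - \<alpha>) * Gamma (1 + \<alpha>)) {0..y}"
proof -
  have "((\<lambda>t. t powr (\<alpha> - 1) * (1 - t) powr ((1 - \<alpha>) - 1)) has_integral Beta \<alpha> (1 - \<alpha>)) {0..1}"
    by (rule has_integral_Beta_real) (use assms in auto)
  from has_integral_stretch_real[OF this, of "1 / y"] assms
  have "((\<lambda>t. (t / y) powr (\<alpha> - 1) * (1 - t / y) powr (-\<alpha>)) has_integral y * Beta \<alpha> (1 - \<alpha>)) {0..y}"
    by (simp add: image_mult_atLeastAtMost_if')
  from has_integral_mult_right[OF this, of "\<alpha> / y"] 
  have B: "((\<lambda>t. \<alpha> / y * ((t / y) powr (\<alpha> - 1) * (1 - t / y) powr (-\<alpha>))) has_integral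
      \<alpha> * Beta \<alpha> (1 - \<alpha>)) {0..y}"
    using assms by (simp add: mult.assoc)
  have "\<alpha> \<notin> \<int>\<^sub>\<le>\<^sub>0"
    using assms nonpos_Ints_nonpos[of \<alpha>] by linarith
  hence "\<alpha> * Beta \<alpha> (1 - \<alpha>) = Gamma (1 - \<alpha>) * Gamma (1 + \<alpha>)"
    using Gamma_plus1[of \<alpha>] by (simp add: Beta_def add.commute)
  with B have B': "((\<lambda>t. \<alpha> / y * ((t / y) powr (\<alpha> - 1) * (1 - t / y) powr (-\<alpha>))) has_integral
      Gamma (1 - \<alpha>) * Gamma (1 + \<alpha>)) {0..y}" by simp
  show ?thesis
  proof (rule has_integral_eq[OF _ B'])
    fix t assume t: "t \<in> {0..y}"
    have y: "y powr (\<alpha> - 1) * y powr (-\<alpha>) = 1 / y"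
    proof -
      have "y powr (\<alpha> - 1) * y powr (-\<alpha>) = y powr (-1)" by (simp flip: powr_add)
      thus ?thesis using assms by (simp add: powr_minus_divide)
    qed
    have "(1 - t / y) powr (-\<alpha>) = (y - t) powr (-\<alpha>) / y powr (-\<alpha>)"
      using assms t by (subst powr_divide[symmetric]) (auto simp: field_simps)
    moreover have "(t / y) powr (\<alpha> - 1) = t powr (\<alpha> - 1) / y powr (\<alpha> - 1)"
      using assms t by (simp add: powr_divide)
    ultimately have "\<alpha> / y * ((t / y) powr (\<alpha> - 1) * (1 - t / y) powr (-\<alpha>)) =
        \<alpha> / y * (t powr (\<alpha> - 1) * (y - t) powr (-\<alpha>)) / (y powr (\<alpha> - 1) * y powr (-\<alpha>))"
      by simp
    also have "\<dots> = (y - t) powr (-\<alpha>) * (\<alpha> * t powr (\<alpha> - 1))"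
      unfolding y using assms by simp
    finally show "\<alpha> / y * ((t / y) powr (\<alpha> - 1) * (1 - t / y) powr (-\<alpha>)) =
        (y - t) powr (-\<alpha>) * (\<alpha> * t powr (\<alpha> - 1))" .
  qed
qed

text \<open>
  The comparison functions: both \<open>w\<^sub>x\<^sub>x\<close> and \<open>D\<^bsup>\<alpha>\<^esup> w\<close> are the constant \<open>c\<close>.
\<close>

lemma frac_heat_parabola:
  assumes "0 < \<alpha>" "\<alpha> < 1"
  shows "frac_heat \<alpha> a b T
    (\<lambda>x y. p + q * (x - x0) + c * (x - x0)\<^sup>2 / 2 + c * y powr \<alpha> / Gamma (1 + \<alpha>))"
proof -
  have G: "Gamma (1 + \<alpha>) > 0" using assms by simp
  have "frac_heat_derivs \<alpha> a b T
      (\<lambda>x y. p + q * (x - x0) + c * (x - x0)\<^sup>2 / 2 + c * y powr \<alpha> / Gamma (1 + \<alpha>))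
      (\<lambda>x y. q + c * (x - x0)) (\<lambda>x y. c) (\<lambda>x y. c / Gamma (1 + \<alpha>) * (\<alpha> * y powr (\<alpha> - 1)))"
    unfolding frac_heat_derivs_def
  proof (intro allI impI conjI, goal_cases)
    case (1 x y)
    show ?case by (auto intro!: derivative_eq_intros simp: field_simps)
  next
    case (2 x y)
    show ?case by (auto intro!: derivative_eq_intros)
  next
    case (3 x y)
    thus ?case using G by (auto intro!: derivative_eq_intros)
  next
    case (4 x y)
    hence "0 < y" by blast
    thus ?case
      using has_integral_mult_right[OF caputo_integral_powr[OF assms \<open>0 < y\<close>], of "c / Gamma (1 + \<alpha>)"] G
      by (simp add: mult_ac)
  qed
  thus ?thesis unfolding frac_heat_def by blast
qed

text \<open>
  The barrier \<open>V\<close> is the solution of \<open>frac_heat_parabola\<close> that agrees to first order with \<open>w\<close> at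
  \<open>(x0, 0)\<close> but has the larger second derivative \<open>c\<close>. So \<open>w < V\<close> on the initial line near \<open>x0\<close>,
  except at \<open>x0\<close> itself, and by continuity \<open>w < V\<close> persists for a short time on the two vertical
  lines \<open>x = x0 - \<delta>\<close> and \<open>x = x0 + \<delta>\<close>. The comparison principle carries the inequality inside.
\<close>

lemma frac_heat_initial_upper:
  fixes w :: "real \<Rightarrow> real \<Rightarrow> real" and \<tau>' :: "real \<Rightarrow> real"
  assumes \<alpha>: "0 < \<alpha>" "\<alpha> < 1"
    and w: "frac_heat \<alpha> 0 1 1 w"
    and cont: "continuous_on ({0..1} \<times> {0..1}) (\<lambda>(x, y). w x y)"
    and x0: "0 < x0" "x0 < 1"
    and d1: "\<And>x. 0 < x \<Longrightarrow> x < 1 \<Longrightarrow> ((\<lambda>s. w s 0) has_real_derivative \<tau>' x) (at x)"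
    and d2: "(\<tau>' has_real_derivative l) (at x0)"
    and c: "l < c"
  shows "\<forall>\<^sub>F y in at_right 0. w x0 y \<le> w x0 0 + c * y powr \<alpha> / Gamma (1 + \<alpha>)"
proof -
  define v where "v x = w x0 0 + \<tau>' x0 * (x - x0) + c * (x - x0)\<^sup>2 / 2" for x
  have G: "Gamma (1 + \<alpha>) > 0" using \<alpha> by simp
  have v': "(v has_real_derivative \<tau>' x0 + c * (x - x0)) (at x)" for x
    unfolding v_def by (auto intro!: derivative_eq_intros simp: field_simps)
  define \<theta> where "\<theta> x = v x - w x 0" for x
  define \<theta>' where "\<theta>' x = \<tau>' x0 + c * (x - x0) - \<tau>' x" for x
  have \<theta>': "(\<theta> has_real_derivative \<theta>' x) (at x)" if "0 < x" "x < 1" for x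
    unfolding \<theta>_def \<theta>'_def by (intro DERIV_diff v' d1 that)
  have \<theta>'': "(\<theta>' has_real_derivative c - l) (at x0)"
    unfolding \<theta>'_def by (auto intro!: derivative_eq_intros d2)
  have [simp]: "\<theta> x0 = 0" "\<theta>' x0 = 0"
    by (auto simp: \<theta>_def \<theta>'_def v_def)
  obtain d1 d2 where d: "d1 > 0" "\<And>h. 0 < h \<Longrightarrow> h < d1 \<Longrightarrow> 0 < \<theta>' (x0 + h)"
      "d2 > 0" "\<And>h. 0 < h \<Longrightarrow> h < d2 \<Longrightarrow> \<theta>' (x0 - h) < 0"
    using DERIV_pos_inc_right[OF \<theta>''] DERIV_pos_inc_left[OF \<theta>''] c by auto
  define \<delta> where "\<delta> = min (min d1 d2) (min x0 (1 - x0)) / 2"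
  have \<delta>: "0 < \<delta>" "\<delta> < d1" "\<delta> < d2" "0 < x0 - \<delta>" "x0 + \<delta> < 1"
    using d(1,3) x0 unfolding \<delta>_def min_def by (auto simp: field_simps)
  \<comment> \<open>\<open>\<theta>'\<close> changes sign from negative to positive at \<open>x0\<close>, hence \<open>\<theta>\<close> has a strict minimum there.\<close>
  have pos: "0 < \<theta> x" if "x \<noteq> x0" "x0 - \<delta> \<le> x" "x \<le> x0 + \<delta>" for x
  proof (cases "x0 < x")
    case True
    have "\<exists>z. x0 < z \<and> z < x \<and> \<theta> x - \<theta> x0 = (x - x0) * \<theta>' z"
      by (rule MVT2[OF True]) (use \<delta> x0 that in \<open>intro \<theta>'; simp\<close>)
    then obtain z where "x0 < z" "z < x" "\<theta> x - \<theta> x0 = (x - x0) * \<theta>' z"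
      by blast
    thus ?thesis using d(2)[of "z - x0"] that \<delta> True by auto
  next
    case False
    hence "x < x0" using that by simp
    have "\<exists>z. x < z \<and> z < x0 \<and> \<theta> x0 - \<theta> x = (x0 - x) * \<theta>' z"
      by (rule MVT2[OF \<open>x < x0\<close>]) (use \<delta> x0 that in \<open>intro \<theta>'; simp\<close>)
    then obtain z where z: "x < z" "z < x0" "\<theta> x0 - \<theta> x = (x0 - x) * \<theta>' z"
      by blast
    hence "\<theta>' z < 0" using d(4)[of "x0 - z"] that \<delta> by auto
    hence "(x0 - x) * \<theta>' z < 0" using z by (intro mult_pos_neg) auto
    thus ?thesis using z by simp
  qed
  define V where "V x y = v x + c * y powr \<alpha> / Gamma (1 + \<alpha>)" for x y
  let ?W = "\<lambda>x y. w x y - V x y"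
  have W: "frac_heat \<alpha> 0 1 1 ?W"
    unfolding V_def v_def by (intro frac_heat_diff w frac_heat_parabola \<alpha>)
  have contW: "continuous_on ({0..1} \<times> {0..1}) (\<lambda>(x, y). ?W x y)"
  proof -
    have "Gamma (1 + \<alpha>) \<noteq> 0" using G by simp
    thus ?thesis
      using cont \<alpha> unfolding V_def v_def case_prod_beta
      by (intro continuous_intros continuous_on_powr') auto
  qed
  have side: "\<forall>\<^sub>F y in at_right 0. ?W x y < 0" if "0 \<le> x" "x \<le> 1" "\<theta> x > 0" for x
  proof -
    have "continuous_on {0..1} ((\<lambda>(x, y). ?W x y) \<circ> (\<lambda>y. (x, y)))"
      by (intro continuous_on_compose continuous_intros continuous_on_subset[OF contW])
         (use that in auto)
    hence "((\<lambda>y. ?W x y) \<longlongrightarrow> ?W x 0) (at 0 within {0..1})"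
      unfolding continuous_on_def o_def by simp
    hence "((\<lambda>y. ?W x y) \<longlongrightarrow> ?W x 0) (at_right 0)"
      by (simp add: at_within_Icc_at_right)
    moreover have "?W x 0 < 0" using that \<alpha> by (simp add: V_def \<theta>_def)
    ultimately show ?thesis by (rule order_tendstoD)
  qed
  have "\<forall>\<^sub>F y in at_right 0. ?W (x0 - \<delta>) y < 0 \<and> ?W (x0 + \<delta>) y < 0"
    by (intro eventually_conj side pos) (use \<delta> x0 in auto)
  then obtain e where e: "e > 0" "\<And>y. 0 < y \<Longrightarrow> y < e \<Longrightarrow> ?W (x0 - \<delta>) y < 0 \<and> ?W (x0 + \<delta>) y < 0"
    unfolding eventually_at_right_field by auto
  have "\<forall>\<^sub>F y::real in at_right 0. 0 < y \<and> y < min e 1"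
    using eventually_at_right_real[of 0 "min e 1"] e by simp
  thus ?thesis
  proof eventually_elim
    case (elim y)
    have bot: "?W x 0 \<le> 0" if "x0 - \<delta> \<le> x" "x \<le> x0 + \<delta>" for x
      using pos[of x] that \<alpha> by (cases "x = x0") (auto simp: \<theta>_def V_def v_def)
    have "?W x0 y \<le> 0"
    proof (rule frac_heat_comparison[OF \<alpha> frac_heat_subset[OF W, of "x0 - \<delta>" "x0 + \<delta>" 1]])
      show "continuous_on ({x0 - \<delta>..x0 + \<delta>} \<times> {0..y}) (\<lambda>(x, y). ?W x y)"
        by (rule continuous_on_subset[OF contW]) (use \<delta> elim in auto)
      fix y' assume y': "0 \<le> y'" "y' \<le> y"
      show "?W (x0 - \<delta>) y' \<le> 0" "?W (x0 + \<delta>) y' \<le> 0"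
        using e(2)[of y'] y' elim bot[of "x0 - \<delta>"] bot[of "x0 + \<delta>"] \<delta>
        by (cases "y' = 0"; force)+
    qed (use \<delta> elim bot in auto)
    thus ?case by (simp add: V_def v_def)
  qed
qed

text \<open>
  The bound from below is the bound from above for \<open>- w\<close>.
\<close>

lemma frac_heat_initial_rate:
  fixes w :: "real \<Rightarrow> real \<Rightarrow> real" and \<tau>' :: "real \<Rightarrow> real"
  assumes \<alpha>: "0 < \<alpha>" "\<alpha> < 1"
    and w: "frac_heat \<alpha> 0 1 1 w"
    and cont: "continuous_on ({0..1} \<times> {0..1}) (\<lambda>(x, y). w x y)"
    and x0: "0 < x0" "x0 < 1"
    and d1: "\<And>x. 0 < x \<Longrightarrow> x < 1 \<Longrightarrow> ((\<lambda>s. w s 0) has_real_derivative \<tau>' x) (at x)"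
    and d2: "(\<tau>' has_real_derivative l) (at x0)"
  shows "((\<lambda>y. (w x0 y - w x0 0) / y powr \<alpha>) \<longlongrightarrow> l / Gamma (1 + \<alpha>)) (at_right 0)"
proof (rule order_tendstoI)
  have G: "Gamma (1 + \<alpha>) > 0" using \<alpha> by simp
  have pos: "\<forall>\<^sub>F y::real in at_right 0. 0 < y" by (simp add: eventually_at_right_less)
  {
    fix a assume a: "l / Gamma (1 + \<alpha>) < a"
    define c where "c = (l + a * Gamma (1 + \<alpha>)) / 2"
    have c: "l < c" "c < a * Gamma (1 + \<alpha>)"
      using a G by (auto simp: c_def field_simps)
    have "\<forall>\<^sub>F y in at_right 0. w x0 y \<le> w x0 0 + c * y powr \<alpha> / Gamma (1 + \<alpha>)"
      by (rule frac_heat_initial_upper[OF \<alpha> w cont x0 d1 d2 c(1)])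
    with pos show "\<forall>\<^sub>F y in at_right 0. (w x0 y - w x0 0) / y powr \<alpha> < a"
    proof eventually_elim
      case (elim y)
      hence "(w x0 y - w x0 0) / y powr \<alpha> \<le> c / Gamma (1 + \<alpha>)" by (simp add: field_simps)
      also have "\<dots> < a" using c G by (simp add: field_simps)
      finally show ?case .
    qed
  }
  {
    fix a assume a: "a < l / Gamma (1 + \<alpha>)"
    define c where "c = (l + a * Gamma (1 + \<alpha>)) / 2"
    have c: "- l < - c" "a * Gamma (1 + \<alpha>) < c"
      using a G by (auto simp: c_def field_simps)
    have zero: "frac_heat \<alpha> 0 1 1 (\<lambda>x y. 0)"
      using frac_heat_diff[OF w w] by simp
    have neg: "frac_heat \<alpha> 0 1 1 (\<lambda>x y. - w x y)"
      using frac_heat_diff[OF zero w] by simp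
    have cneg: "continuous_on ({0..1} \<times> {0..1}) (\<lambda>(x, y). - w x y)"
      using cont unfolding case_prod_beta by (intro continuous_intros)
    have "\<forall>\<^sub>F y in at_right 0. - w x0 y \<le> - w x0 0 + (- c) * y powr \<alpha> / Gamma (1 + \<alpha>)"
      by (rule frac_heat_initial_upper[OF \<alpha> neg cneg x0 _ DERIV_minus[OF d2] c(1)])
         (intro DERIV_minus d1)
    with pos show "\<forall>\<^sub>F y in at_right 0. a < (w x0 y - w x0 0) / y powr \<alpha>"
    proof eventually_elim
      case (elim y)
      have "a < c / Gamma (1 + \<alpha>)" using c G by (simp add: field_simps)
      also have "\<dots> \<le> (w x0 y - w x0 0) / y powr \<alpha>" using elim by (simp add: field_simps)
      finally show ?case .
    qed
  }
qed

text \<open>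
  Reads the weighted derivative of the gluing condition as the same short-time rate that
  \<open>frac_heat_initial_rate\<close> computes from the equation.
\<close>

lemma powr_rate_lhopital:
  fixes f f' :: "real \<Rightarrow> real"
  assumes "0 < \<alpha>"
    and cont: "(f \<longlongrightarrow> f 0) (at_right 0)"
    and der: "\<forall>\<^sub>F y in at_right 0. (f has_real_derivative f' y) (at y)"
    and lim: "((\<lambda>y. y powr (1 - \<alpha>) * f' y) \<longlongrightarrow> \<nu>) (at_right 0)"
  shows "((\<lambda>y. (f y - f 0) / y powr \<alpha>) \<longlongrightarrow> \<nu> / \<alpha>) (at_right 0)"
proof (rule lhopital_right_0)
  have pos: "\<forall>\<^sub>F y::real in at_right 0. 0 < y" by (simp add: eventually_at_right_less)
  show "((\<lambda>y. f y - f 0) \<longlongrightarrow> 0) (at_right 0)"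
    using tendsto_diff[OF cont tendsto_const, of "f 0"] by simp
  have "((\<lambda>y. y powr \<alpha>) \<longlongrightarrow> 0 powr \<alpha>) (at_right 0)"
    by (intro tendsto_intros) (use assms in \<open>auto simp: eventually_at_filter\<close>)
  thus "((\<lambda>y. y powr \<alpha>) \<longlongrightarrow> 0) (at_right 0)" by simp
  show "\<forall>\<^sub>F y in at_right 0. y powr \<alpha> \<noteq> 0"
    using pos by eventually_elim simp
  show "\<forall>\<^sub>F y in at_right 0. \<alpha> * y powr (\<alpha> - 1) \<noteq> 0"
    using pos by eventually_elim (use assms in simp)
  show "\<forall>\<^sub>F y in at_right 0. ((\<lambda>y. f y - f 0) has_real_derivative f' y) (at y)"
    using der by eventually_elim (auto intro!: derivative_eq_intros)
  show "\<forall>\<^sub>F y in at_right 0. ((\<lambda>y. y powr \<alpha>) has_real_derivative \<alpha> * y powr (\<alpha> - 1)) (at y)"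
    using pos by eventually_elim (auto intro!: derivative_eq_intros)
  have "((\<lambda>y. (y powr (1 - \<alpha>) * f' y) / \<alpha>) \<longlongrightarrow> \<nu> / \<alpha>) (at_right 0)"
    by (intro tendsto_intros lim) (use assms in auto)
  moreover have "\<forall>\<^sub>F y in at_right 0. (y powr (1 - \<alpha>) * f' y) / \<alpha> = f' y / (\<alpha> * y powr (\<alpha> - 1))"
    using pos by eventually_elim (use assms in \<open>simp add: powr_diff field_simps\<close>)
  ultimately show "((\<lambda>y. f' y / (\<alpha> * y powr (\<alpha> - 1))) \<longlongrightarrow> \<nu> / \<alpha>) (at_right 0)"
    by (rule Lim_transform_eventually)
qed

section \<open>The wave equation in the characteristic triangle\<close>

text \<open>
  The second difference of \<open>u\<close> over a small square, divided by its area, is by the mean value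
  theorem a value of either mixed derivative; continuity forces these two values together.
\<close>

lemma mixed_partials_commute:
  fixes u :: "real \<times> real \<Rightarrow> real"
  assumes S: "open S" "(a, b) \<in> S"
    and ux: "\<And>x y. (x, y) \<in> S \<Longrightarrow> ((\<lambda>s. u (s, y)) has_real_derivative ux (x, y)) (at x)"
    and uy: "\<And>x y. (x, y) \<in> S \<Longrightarrow> ((\<lambda>s. u (x, s)) has_real_derivative uy (x, y)) (at y)"
    and uxy: "\<And>x y. (x, y) \<in> S \<Longrightarrow> ((\<lambda>s. ux (x, s)) has_real_derivative uxy (x, y)) (at y)"
    and uyx: "\<And>x y. (x, y) \<in> S \<Longrightarrow> ((\<lambda>s. uy (s, y)) has_real_derivative uyx (x, y)) (at x)"
    and cont: "continuous_on S uxy" "continuous_on S uyx"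
  shows "uxy (a, b) = uyx (a, b)"
proof (rule ccontr)
  assume "uxy (a, b) \<noteq> uyx (a, b)"
  define e where "e = \<bar>uxy (a, b) - uyx (a, b)\<bar> / 2"
  have e: "e > 0" using \<open>uxy (a, b) \<noteq> uyx (a, b)\<close> by (simp add: e_def)
  have near: "\<forall>\<^sub>F p in nhds (a, b). dist (g p) (g (a, b)) < e" if "continuous_on S g" for g :: "real \<times> real \<Rightarrow> real"
  proof -
    have "isCont g (a, b)"
      using that S continuous_on_eq_continuous_at by blast
    hence "(g \<longlongrightarrow> g (a, b)) (nhds (a, b))"
      by (simp add: isCont_def tendsto_at_iff_tendsto_nhds)
    thus ?thesis using e by (rule tendstoD)
  qed
  have "\<forall>\<^sub>F p in nhds (a, b). p \<in> S \<and> dist (uxy p) (uxy (a, b)) < e \<and> dist (uyx p) (uyx (a, b)) < e"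
    using S by (intro eventually_conj near cont eventually_nhds_in_open)
  then obtain d where d: "d > 0" "\<And>p. dist p (a, b) < d \<Longrightarrow>
      p \<in> S \<and> dist (uxy p) (uxy (a, b)) < e \<and> dist (uyx p) (uyx (a, b)) < e"
    unfolding eventually_nhds_metric by blast
  define h where "h = d / 3"
  have h: "h > 0" using d by (simp add: h_def)
  have box: "dist (x, y) (a, b) < d" if "a \<le> x" "x \<le> a + h" "b \<le> y" "y \<le> b + h" for x y
  proof -
    have "dist (x, y) (a, b) \<le> \<bar>x - a\<bar> + \<bar>y - b\<bar>"
      unfolding dist_Pair_Pair dist_real_def
      using sqrt_sum_squares_le_sum_abs[of "\<bar>x - a\<bar>" "\<bar>y - b\<bar>"] by simp
    also have "\<dots> < d" using that h d by (simp add: h_def)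
    finally show ?thesis .
  qed
  have inS: "(x, y) \<in> S" if "a \<le> x" "x \<le> a + h" "b \<le> y" "y \<le> b + h" for x y
    using d(2) box[OF that] by blast
  \<comment> \<open>The second difference, grouped first by \<open>y\<close> and then by \<open>x\<close>.\<close>
  have "\<exists>\<xi>. a < \<xi> \<and> \<xi> < a + h \<and> (u (a + h, b + h) - u (a + h, b)) - (u (a, b + h) - u (a, b)) =
      (a + h - a) * (ux (\<xi>, b + h) - ux (\<xi>, b))"
    by (rule MVT2) (use h in \<open>auto intro!: DERIV_diff ux inS\<close>)
  then obtain \<xi> where \<xi>: "a < \<xi>" "\<xi> < a + h"
    "(u (a + h, b + h) - u (a + h, b)) - (u (a, b + h) - u (a, b)) = h * (ux (\<xi>, b + h) - ux (\<xi>, b))"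
    by auto
  have "\<exists>\<eta>. b < \<eta> \<and> \<eta> < b + h \<and> ux (\<xi>, b + h) - ux (\<xi>, b) = (b + h - b) * uxy (\<xi>, \<eta>)"
    by (rule MVT2) (use h \<xi> in \<open>auto intro!: uxy inS\<close>)
  then obtain \<eta> where \<eta>: "b < \<eta>" "\<eta> < b + h" "ux (\<xi>, b + h) - ux (\<xi>, b) = h * uxy (\<xi>, \<eta>)"
    by auto
  have "\<exists>\<eta>. b < \<eta> \<and> \<eta> < b + h \<and> (u (a + h, b + h) - u (a, b + h)) - (u (a + h, b) - u (a, b)) =
      (b + h - b) * (uy (a + h, \<eta>) - uy (a, \<eta>))"
    by (rule MVT2) (use h in \<open>auto intro!: DERIV_diff uy inS\<close>)
  then obtain \<eta>' where \<eta>': "b < \<eta>'" "\<eta>' < b + h"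
    "(u (a + h, b + h) - u (a, b + h)) - (u (a + h, b) - u (a, b)) = h * (uy (a + h, \<eta>') - uy (a, \<eta>'))"
    by auto
  have "\<exists>\<xi>. a < \<xi> \<and> \<xi> < a + h \<and> uy (a + h, \<eta>') - uy (a, \<eta>') = (a + h - a) * uyx (\<xi>, \<eta>')"
    by (rule MVT2) (use h \<eta>' in \<open>auto intro!: uyx inS\<close>)
  then obtain \<xi>' where \<xi>': "a < \<xi>'" "\<xi>' < a + h" "uy (a + h, \<eta>') - uy (a, \<eta>') = h * uyx (\<xi>', \<eta>')"
    by auto
  have "h * (ux (\<xi>, b + h) - ux (\<xi>, b)) = h * (uy (a + h, \<eta>') - uy (a, \<eta>'))"
    using \<xi>(3) \<eta>'(3) by linarith
  hence "h * (h * uxy (\<xi>, \<eta>)) = h * (h * uyx (\<xi>', \<eta>'))"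
    unfolding \<eta>(3) \<xi>'(3) .
  hence "uxy (\<xi>, \<eta>) = uyx (\<xi>', \<eta>')" using h by simp
  moreover have "dist (uxy (\<xi>, \<eta>)) (uxy (a, b)) < e" "dist (uyx (\<xi>', \<eta>')) (uyx (a, b)) < e"
    using d(2)[OF box] \<xi> \<eta> \<xi>' \<eta>' by auto
  ultimately have "\<bar>uxy (a, b) - uyx (a, b)\<bar> < 2 * e"
    unfolding dist_real_def by linarith
  thus False by (simp add: e_def)
qed

lemma has_derivative_of_partials:
  fixes u :: "real \<times> real \<Rightarrow> real"
  assumes S: "open S" "(a, b) \<in> S"
    and ux: "((\<lambda>s. u (s, b)) has_real_derivative ux) (at a)"
    and uy: "\<And>x y. (x, y) \<in> S \<Longrightarrow> ((\<lambda>s. u (x, s)) has_real_derivative uy (x, y)) (at y)"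
    and cont: "continuous_on S uy"
  shows "(u has_derivative (\<lambda>(h, k). ux * h + uy (a, b) * k)) (at (a, b))"
proof -
  obtain d where d: "d > 0" "ball (a, b) d \<subseteq> S"
    using S open_contains_ball by blast
  define X Y where "X = {a - d/2 <..< a + d/2}" and "Y = {b - d/2 <..< b + d/2}"
  have XY: "X \<times> Y \<subseteq> S"
  proof safe
    fix x y assume "x \<in> X" "y \<in> Y"
    hence "\<bar>a - x\<bar> + \<bar>b - y\<bar> < d" by (auto simp: X_def Y_def)
    hence "dist (a, b) (x, y) < d"
      unfolding dist_Pair_Pair dist_real_def
      using sqrt_sum_squares_le_sum_abs[of "\<bar>a - x\<bar>" "\<bar>b - y\<bar>"] by simp
    thus "(x, y) \<in> S" using d by auto
  qed
  have ab: "a \<in> X" "b \<in> Y" using d by (auto simp: X_def Y_def)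
  have op: "open (X \<times> Y)" by (auto simp: X_def Y_def intro: open_Times)
  have "((\<lambda>(x, y). u (x, y)) has_derivative
      (\<lambda>(h, k). ux * h + blinfun_apply (blinfun_mult_right (uy (a, b))) k)) (at (a, b) within X \<times> Y)"
  proof (rule has_derivative_partialsI[where f="\<lambda>x y. u (x, y)"])
    show "((\<lambda>s. u (s, b)) has_derivative (\<lambda>h. ux * h)) (at a within X)"
      using has_derivative_at_withinI[OF ux[unfolded has_field_derivative_def]] .
    show "((\<lambda>s. u (x, s)) has_derivative blinfun_apply (blinfun_mult_right (uy (x, y)))) (at y within Y)"
      if "x \<in> X" "y \<in> Y" for x y
    proof -
      have "(x, y) \<in> S" using that XY by blast
      moreover have "blinfun_apply (blinfun_mult_right (uy (x, y))) = (*) (uy (x, y))"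
        by (rule ext) simp
      ultimately show ?thesis
        using has_derivative_at_withinI[OF uy[unfolded has_field_derivative_def]] by simp
    qed
    have "isCont uy (a, b)"
      using cont S continuous_on_eq_continuous_at by blast
    hence "continuous (at (a, b) within X \<times> Y) uy"
      by (rule continuous_at_imp_continuous_at_within)
    hence "continuous (at (a, b) within X \<times> Y) (\<lambda>p. blinfun_mult_right (uy p))"
      by (rule bounded_linear.continuous[OF bounded_linear_blinfun_mult_right])
    thus "continuous (at (a, b) within X \<times> Y) (\<lambda>(x, y). blinfun_mult_right (uy (x, y)))"
      by (simp only: case_prod_beta' prod.collapse)
  qed (use ab in \<open>auto simp: Y_def\<close>)
  moreover have "at (a, b) within X \<times> Y = at (a, b)"
    by (rule at_within_open[OF _ op]) (use ab in blast)
  ultimately show ?thesis by simp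
qed

lemma C1_onD:
  assumes "C1_on u S" "(x, y) \<in> S"
  shows "((\<lambda>s. u (s, y)) has_real_derivative partial_x u (x, y)) (at x)"
    and "((\<lambda>s. u (x, s)) has_real_derivative partial_y u (x, y)) (at y)"
proof -
  have "diff_x_at u (x, y)" "diff_y_at u (x, y)"
    using assms unfolding C1_on_def by blast+
  thus "((\<lambda>s. u (s, y)) has_real_derivative partial_x u (x, y)) (at x)"
    and "((\<lambda>s. u (x, s)) has_real_derivative partial_y u (x, y)) (at y)"
    by (simp_all add: diff_x_at_def diff_y_at_def partial_x_def partial_y_def
        DERIV_deriv_iff_real_differentiable)
qed

lemma C1_on_has_derivative:
  assumes "open S" "C1_on u S" "(a, b) \<in> S"
  shows "(u has_derivative (\<lambda>(h, k). partial_x u (a, b) * h + partial_y u (a, b) * k)) (at (a, b))"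
proof (rule has_derivative_of_partials[OF assms(1,3)])
  show "continuous_on S (partial_y u)"
    using assms(2) unfolding C1_on_def by blast
qed (intro C1_onD[OF assms(2)] assms(3); assumption)+

text \<open>
  The form in which differentiability of a \<open>C\<^sup>1\<close> function is used: along the characteristics.
\<close>

lemma C1_on_line_derivative:
  assumes "open S" "C1_on u S" "(x0 + h * t, y0 + k * t) \<in> S"
  shows "((\<lambda>s. u (x0 + h * s, y0 + k * s)) has_real_derivative
     partial_x u (x0 + h * t, y0 + k * t) * h + partial_y u (x0 + h * t, y0 + k * t) * k) (at t)"
proof -
  have "((\<lambda>s. (x0 + h * s, y0 + k * s)) has_derivative (\<lambda>r. (h * r, k * r))) (at t)"
    by (auto intro!: derivative_eq_intros)
  from diff_chain_at[OF this C1_on_has_derivative[OF assms]]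
  show ?thesis
    unfolding has_field_derivative_def o_def
    by (rule has_derivative_eq_rhs) (auto simp: algebra_simps)
qed

lemma open_Omega_minus: "open Omega_minus"
proof -
  have eq: "Omega_minus = {p. - snd p < fst p} \<inter> {p. fst p < snd p + 1} \<inter> {p. - (1/2) < snd p} \<inter> {p. snd p < 0}"
    by (auto simp: Omega_minus_def)
  show ?thesis
    unfolding eq by (intro open_Int open_Collect_less continuous_intros)
qed

lemma square_in_closure:
  assumes "0 \<le> x" "x \<le> 1" "0 \<le> y" "y \<le> 1"
  shows "(x, y) \<in> closure Omega"
proof -
  have eq: "Omega_plus = {0<..<1} \<times> {0<..<1}"
    by (auto simp: Omega_plus_def)
  have "closure Omega_plus = {0..1} \<times> {0..1}"
    unfolding eq closure_Times by simp
  moreover have "closure Omega_plus \<subseteq> closure Omega"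
    by (rule closure_mono) (auto simp: Omega_def)
  ultimately show ?thesis using assms by auto
qed

text \<open>
  The points strictly between such a point and the inner point \<open>(1/2, -1/4)\<close> lie in the open
  triangle.
\<close>

lemma triangle_in_closure:
  assumes "- y \<le> x" "x \<le> y + 1" "y \<le> 0"
  shows "(x, y) \<in> closure Omega"
proof -
  define g where "g s = (x + s * (1/2 - x), y + s * (-1/4 - y))" for s :: real
  have "g s \<in> Omega_minus" if "s \<in> {0<..<1}" for s
  proof -
    have s: "0 < s" "0 < 1 - s" using that by auto
    have "0 \<le> (1 - s) * (x + y)" "0 \<le> (1 - s) * (y + 1 - x)" "(1 - s) * y \<le> 0"
      "0 \<le> (1 - s) * (1/2 + y)"
      using assms s by (auto intro!: mult_nonneg_nonneg mult_nonneg_nonpos)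
    thus ?thesis using s by (auto simp: g_def Omega_minus_def algebra_simps)
  qed
  hence "g ` {0<..<1} \<subseteq> closure Omega_minus"
    using closure_subset by blast
  hence "g ` closure {0<..<1} \<subseteq> closure Omega_minus"
    by (intro image_closure_subset) (auto simp: g_def intro!: continuous_intros)
  hence "g 0 \<in> closure Omega_minus" by auto
  moreover have "closure Omega_minus \<subseteq> closure Omega"
    by (rule closure_mono) (auto simp: Omega_def)
  ultimately show ?thesis by (auto simp: g_def)
qed

text \<open>
  In the coordinates \<open>\<xi> = x + y\<close>, \<open>\<eta> = x - y\<close> the triangle is \<open>0 < \<xi> < \<eta> < 1\<close>. By the wave
  equation \<open>u\<^sub>x + u\<^sub>y\<close>, which is twice the \<open>\<xi>\<close>-derivative, does not depend on \<open>\<eta>\<close>. So the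
  difference of \<open>u\<close> between two fixed values of \<open>\<eta>\<close> does not depend on \<open>\<xi>\<close>; it is compared at
  \<open>\<xi> = 0\<close>, the left characteristic, and at the point where the line with the smaller \<open>\<eta>\<close> meets
  \<open>y = 0\<close>.
\<close>

lemma dAlembert_representation:
  assumes C2: "C2_on u Omega_minus"
    and cont: "continuous_on (closure Omega) u"
    and wave: "\<And>x y. (x, y) \<in> Omega_minus \<Longrightarrow>
      partial_x (partial_x u) (x, y) = partial_y (partial_y u) (x, y)"
    and xy: "(x, y) \<in> Omega_minus"
  shows "u (x, y) = u (x + y, 0) + u ((x - y) / 2, - ((x - y) / 2)) - u ((x + y) / 2, - ((x + y) / 2))"
proof -
  let ?ux = "partial_x u" and ?uy = "partial_y u"
  note C1 = C2[unfolded C2_on_def]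
  have mixed: "partial_y ?ux (a, b) = partial_x ?uy (a, b)" if "(a, b) \<in> Omega_minus" for a b
  proof (rule mixed_partials_commute[OF open_Omega_minus that, of u ?ux ?uy])
    show "continuous_on Omega_minus (partial_y ?ux)" "continuous_on Omega_minus (partial_x ?uy)"
      using C1 unfolding C1_on_def by blast+
  qed (use C1 C1_onD in blast)+
  define \<xi> \<eta> where "\<xi> = x + y" and "\<eta> = x - y"
  have \<xi>\<eta>: "0 < \<xi>" "\<xi> < \<eta>" "\<eta> < 1"
    using xy by (auto simp: Omega_minus_def \<xi>_def \<eta>_def)
  have char_in: "(s/2 + 1/2 * t, s/2 + (-1/2) * t) \<in> Omega_minus" if "0 < s" "s < t" "t < 1" for s t
    using that by (auto simp: Omega_minus_def)
  have Ux: "((\<lambda>s. u (t/2 + 1/2 * s, - t/2 + 1/2 * s)) has_real_derivative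
     (?ux (s/2 + 1/2 * t, s/2 + (-1/2) * t) + ?uy (s/2 + 1/2 * t, s/2 + (-1/2) * t)) / 2) (at s)"
    if "0 < s" "s < t" "t < 1" for s t
    using C1_on_line_derivative[OF open_Omega_minus, of u "t/2" "1/2" s "- t/2" "1/2"] C1 char_in[OF that]
    by (simp add: field_simps)
  have q: "?ux (s/2 + 1/2 * \<eta>, s/2 + (-1/2) * \<eta>) + ?uy (s/2 + 1/2 * \<eta>, s/2 + (-1/2) * \<eta>) =
      ?ux (s/2 + 1/2 * \<xi>, s/2 + (-1/2) * \<xi>) + ?uy (s/2 + 1/2 * \<xi>, s/2 + (-1/2) * \<xi>)"
    if s: "0 < s" "s < \<xi>" for s
  proof (rule DERIV_isconst_end[OF \<xi>\<eta>(2)])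
    have *: "((\<lambda>t. ?ux (s/2 + 1/2 * t, s/2 + (-1/2) * t) + ?uy (s/2 + 1/2 * t, s/2 + (-1/2) * t))
        has_real_derivative 0) (at t)" if "\<xi> \<le> t" "t \<le> \<eta>" for t
    proof -
      let ?c = "(s/2 + 1/2 * t, s/2 + (-1/2) * t)"
      have c: "?c \<in> Omega_minus" using char_in[of s t] that s \<xi>\<eta> by auto
      have "((\<lambda>t. ?ux (s/2 + 1/2 * t, s/2 + (-1/2) * t) + ?uy (s/2 + 1/2 * t, s/2 + (-1/2) * t))
        has_real_derivative (partial_x ?ux ?c * (1/2) + partial_y ?ux ?c * (-1/2)) +
          (partial_x ?uy ?c * (1/2) + partial_y ?uy ?c * (-1/2))) (at t)"
        by (intro DERIV_add C1_on_line_derivative[OF open_Omega_minus] c) (use C1 in auto)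
      thus ?thesis using mixed[OF c] wave[OF c] by simp
    qed
    show "continuous_on {\<xi>..\<eta>}
      (\<lambda>t. ?ux (s/2 + 1/2 * t, s/2 + (-1/2) * t) + ?uy (s/2 + 1/2 * t, s/2 + (-1/2) * t))"
      by (rule DERIV_atLeastAtMost_imp_continuous_on) (use * in blast)
    show "((\<lambda>t. ?ux (s/2 + 1/2 * t, s/2 + (-1/2) * t) + ?uy (s/2 + 1/2 * t, s/2 + (-1/2) * t))
        has_real_derivative 0) (at t)" if "\<xi> < t" "t < \<eta>" for t
      using * that by simp
  qed
  \<comment> \<open>The smaller of the two values of \<open>\<eta>\<close> is \<open>\<xi>\<close> itself, so that \<open>D \<xi>\<close> involves a point of \<open>y = 0\<close>.\<close>
  define D where "D s = u (\<eta>/2 + 1/2 * s, - \<eta>/2 + 1/2 * s) - u (\<xi>/2 + 1/2 * s, - \<xi>/2 + 1/2 * s)" for s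
  have contD: "continuous_on {0..\<xi>} (\<lambda>s. u (t/2 + 1/2 * s, - t/2 + 1/2 * s))" if "\<xi> \<le> t" "t \<le> \<eta>" for t
    by (rule continuous_on_compose2[OF cont])
       (use that \<xi>\<eta> in \<open>auto intro!: continuous_intros triangle_in_closure simp: field_simps\<close>)
  have "D \<xi> = D 0"
  proof (rule DERIV_isconst_end[OF \<xi>\<eta>(1)])
    show "continuous_on {0..\<xi>} D"
      unfolding D_def by (intro continuous_on_diff contD) (use \<xi>\<eta> in auto)
    show "(D has_real_derivative 0) (at s)" if s: "0 < s" "s < \<xi>" for s
      using DERIV_diff[OF Ux[of s \<eta>] Ux[of s \<xi>]] s \<xi>\<eta> q[OF s] unfolding D_def by auto
  qed
  moreover have "D \<xi> = u (x, y) - u (x + y, 0)"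
  proof -
    have "\<eta>/2 + 1/2 * \<xi> = x" "- \<eta>/2 + 1/2 * \<xi> = y" "\<xi>/2 + 1/2 * \<xi> = x + y" "- \<xi>/2 + 1/2 * \<xi> = 0"
      by (simp_all add: \<xi>_def \<eta>_def field_simps)
    thus ?thesis unfolding D_def by (simp only:)
  qed
  moreover have "D 0 = u ((x - y) / 2, - ((x - y) / 2)) - u ((x + y) / 2, - ((x + y) / 2))"
    by (simp add: D_def \<xi>_def \<eta>_def minus_divide_left)
  ultimately show ?thesis by simp
qed

section \<open>A nonlocal boundary value problem on the segment\<close>

lemma DERIV_eventually_eq:
  assumes "(f has_real_derivative D) (at x)" and "\<forall>\<^sub>F y in nhds x. f y = g y"
  shows "(g has_real_derivative D) (at x)"
  using DERIV_cong_ev[OF refl assms(2) refl] assms(1) by blast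

text \<open>
  Multiplying the equation for \<open>\<tau>''\<close> by \<open>\<tau>\<close> shows that
  \<open>E = \<tau> \<tau>' - \<beta> \<tau>\<^sup>2 / 2 - \<mu> G\<^sup>2 / 2\<close> is nondecreasing, with \<open>E' = \<tau>'\<^sup>2 + \<mu> k \<tau>\<^sup>2\<close>. Since nothing is known
  about \<open>\<tau>'\<close> at the ends of the interval, the energy identity is not integrated. Instead the sign of
  \<open>E\<close> is bounded at each end by that of \<open>\<tau> \<tau>' = (\<tau>\<^sup>2)' / 2\<close>: if \<open>E\<close> were negative somewhere, \<open>\<tau>\<^sup>2\<close> would
  decrease from its value \<open>0\<close> at the left end, and if \<open>E\<close> were positive somewhere, \<open>\<tau>\<^sup>2\<close> would
  increase to its value \<open>0\<close> at the right end. So \<open>E = 0\<close>, and \<open>E' = 0\<close> gives \<open>\<tau>' = 0\<close>.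
\<close>

lemma nonlocal_problem_trivial:
  fixes \<tau> \<tau>' G k Q1 :: "real \<Rightarrow> real"
  assumes cont: "continuous_on {0..1} \<tau>" and "\<tau> 0 = 0" "\<tau> 1 = 0"
    and \<tau>: "\<And>x. 0 < x \<Longrightarrow> x < 1 \<Longrightarrow> (\<tau> has_real_derivative \<tau>' x) (at x)"
    and \<tau>': "\<And>x. 0 < x \<Longrightarrow> x < 1 \<Longrightarrow>
      (\<tau>' has_real_derivative \<beta> * \<tau>' x + \<mu> * (k x * \<tau> x + Q1 x * G x)) (at x)"
    and G: "\<And>x. 0 < x \<Longrightarrow> x < 1 \<Longrightarrow> (G has_real_derivative \<tau> x * Q1 x) (at x)"
    and G0: "(G \<longlongrightarrow> 0) (at_right 0)"
    and nonneg: "0 \<le> \<mu>" "\<And>x. 0 < x \<Longrightarrow> x < 1 \<Longrightarrow> 0 < k x"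
    and x: "0 \<le> x" "x \<le> 1"
  shows "\<tau> x = 0"
proof -
  define E where "E x = \<tau> x * \<tau>' x - \<beta> * (\<tau> x)\<^sup>2 / 2 - \<mu> * (G x)\<^sup>2 / 2" for x
  have E': "(E has_real_derivative (\<tau>' x)\<^sup>2 + \<mu> * k x * (\<tau> x)\<^sup>2) (at x)" if "0 < x" "x < 1" for x
    unfolding E_def
    by (auto intro!: derivative_eq_intros \<tau>[OF that] \<tau>'[OF that] G[OF that]
        simp: power2_eq_square algebra_simps)
  have E'_nonneg: "0 \<le> (\<tau>' x)\<^sup>2 + \<mu> * k x * (\<tau> x)\<^sup>2" if "0 < x" "x < 1" for x
    using nonneg that by (simp add: less_imp_le)
  have mono: "E x \<le> E y" if "0 < x" "x \<le> y" "y < 1" for x y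
    by (rule DERIV_nonneg_imp_nondecreasing[OF that(2)])
       (use E' E'_nonneg that in \<open>meson order_less_le_trans order_le_less_trans\<close>)
  have sq: "((\<lambda>x. (\<tau> x)\<^sup>2) has_real_derivative 2 * (\<tau> x * \<tau>' x)) (at x)" if "0 < x" "x < 1" for x
    by (auto intro!: derivative_eq_intros \<tau>[OF that])
  have contsq: "continuous_on {0..1} (\<lambda>x. (\<tau> x)\<^sup>2)"
    by (intro continuous_intros cont)
  have "(\<tau> \<longlongrightarrow> \<tau> 0) (at 0 within {0..1})" "(\<tau> \<longlongrightarrow> \<tau> 1) (at 1 within {0..1})"
    using cont unfolding continuous_on_def by simp_all
  hence \<tau>0: "(\<tau> \<longlongrightarrow> 0) (at_right 0)" and \<tau>1: "(\<tau> \<longlongrightarrow> 0) (at_left 1)"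
    using assms(2,3) by (simp_all add: at_within_Icc_at_right at_within_Icc_at_left)
  have "E x = 0" if x: "0 < x" "x < 1" for x
  proof (rule antisym)
    show "0 \<le> E x"
    proof (rule ccontr)
      assume "\<not> 0 \<le> E x"
      \<comment> \<open>By monotonicity, \<open>\<tau> \<tau>'\<close> is at most this function to the left of \<open>x\<close>.\<close>
      have "((\<lambda>z. E x + \<beta> * (\<tau> z)\<^sup>2 / 2 + \<mu> * (G z)\<^sup>2 / 2) \<longlongrightarrow> E x + \<beta> * 0\<^sup>2 / 2 + \<mu> * 0\<^sup>2 / 2) (at_right 0)"
        by (intro tendsto_intros \<tau>0 G0) auto
      hence "\<forall>\<^sub>F z in at_right 0. E x + \<beta> * (\<tau> z)\<^sup>2 / 2 + \<mu> * (G z)\<^sup>2 / 2 < 0"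
        using \<open>\<not> 0 \<le> E x\<close> by (intro order_tendstoD(2)) auto
      then obtain e where e: "e > 0" "\<And>z. 0 < z \<Longrightarrow> z < e \<Longrightarrow> E x + \<beta> * (\<tau> z)\<^sup>2 / 2 + \<mu> * (G z)\<^sup>2 / 2 < 0"
        unfolding eventually_at_right_field by auto
      define b where "b = min e x"
      have b: "0 < b" "b \<le> e" "b \<le> x" using e x by (auto simp: b_def)
      have neg: "\<tau> z * \<tau>' z < 0" if "0 < z" "z < b" for z
        using e(2)[of z] mono[of z x] that b x unfolding E_def[of z] by auto
      have "(\<tau> 0)\<^sup>2 > (\<tau> b)\<^sup>2"
      proof (intro DERIV_neg_imp_decreasing_open[OF b(1)] exI conjI)
        fix z assume z: "0 < z" "z < b"
        show "((\<lambda>x. (\<tau> x)\<^sup>2) has_real_derivative 2 * (\<tau> z * \<tau>' z)) (at z)"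
          using z b x by (intro sq) auto
        show "2 * (\<tau> z * \<tau>' z) < 0" using neg[OF z] by simp
      qed (rule continuous_on_subset[OF contsq], use b x in auto)
      thus False using assms(2) by simp
    qed
    show "E x \<le> 0"
    proof (rule ccontr)
      assume "\<not> E x \<le> 0"
      \<comment> \<open>To the right of \<open>x\<close>, \<open>\<tau> \<tau>'\<close> is at least this function; \<open>G\<close> may be unbounded near \<open>1\<close>, but its term has the right sign.\<close>
      have "((\<lambda>z. E x + \<beta> * (\<tau> z)\<^sup>2 / 2) \<longlongrightarrow> E x + \<beta> * 0\<^sup>2 / 2) (at_left 1)"
        by (intro tendsto_intros \<tau>1) auto
      hence "\<forall>\<^sub>F z in at_left 1. 0 < E x + \<beta> * (\<tau> z)\<^sup>2 / 2"
        using \<open>\<not> E x \<le> 0\<close> by (intro order_tendstoD(1)) auto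
      then obtain e where e: "e < 1" "\<And>z. e < z \<Longrightarrow> z < 1 \<Longrightarrow> 0 < E x + \<beta> * (\<tau> z)\<^sup>2 / 2"
        unfolding eventually_at_left_field by auto
      define b where "b = max e x"
      have b: "b < 1" "e \<le> b" "x \<le> b" using e x by (auto simp: b_def)
      have pos: "0 < \<tau> z * \<tau>' z" if "b < z" "z < 1" for z
      proof -
        have "0 \<le> \<mu> * (G z)\<^sup>2 / 2" using nonneg by simp
        thus ?thesis
          using e(2)[of z] mono[of x z] that b x unfolding E_def[of z] by linarith
      qed
      have "(\<tau> b)\<^sup>2 < (\<tau> 1)\<^sup>2"
      proof (intro DERIV_pos_imp_increasing_open[OF b(1)] exI conjI)
        fix z assume z: "b < z" "z < 1"
        show "((\<lambda>x. (\<tau> x)\<^sup>2) has_real_derivative 2 * (\<tau> z * \<tau>' z)) (at z)"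
          using z b x by (intro sq) auto
        show "0 < 2 * (\<tau> z * \<tau>' z)" using pos[OF z] by simp
      qed (rule continuous_on_subset[OF contsq], use b x in auto)
      thus False using assms(3) by simp
    qed
  qed
  have der0: "(\<tau> has_real_derivative 0) (at x)" if x: "0 < x" "x < 1" for x
  proof -
    have "(E has_real_derivative 0) (at x)"
    proof (rule DERIV_cong_ev[THEN iffD2, OF refl _ refl])
      have "\<forall>\<^sub>F z in nhds x. z \<in> {0<..<1}"
        using x by (intro eventually_nhds_in_open) auto
      thus "\<forall>\<^sub>F z in nhds x. E z = 0"
        by eventually_elim (use \<open>\<And>x. 0 < x \<Longrightarrow> x < 1 \<Longrightarrow> E x = 0\<close> in auto)
    qed auto
    hence "(\<tau>' x)\<^sup>2 + \<mu> * k x * (\<tau> x)\<^sup>2 = 0"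
      using E'[OF x] DERIV_unique by blast
    moreover have "0 \<le> \<mu> * k x * (\<tau> x)\<^sup>2" using nonneg x by (simp add: less_imp_le)
    ultimately have "(\<tau>' x)\<^sup>2 \<le> 0" by linarith
    thus ?thesis using \<tau>[OF x] by simp
  qed
  show ?thesis
  proof (cases "x = 0")
    case False
    hence "0 < x" using x by simp
    have "\<tau> x = \<tau> 0"
      by (rule DERIV_isconst_end[OF \<open>0 < x\<close> continuous_on_subset[OF cont]]) (use x der0 in auto)
    thus ?thesis using assms(2) by simp
  qed (use assms(2) in simp)
qed

text \<open>
  If \<open>P' = Q1\<close> then \<open>Q x t = Q x x - Q1 x * (P t - P x)\<close>, so that \<open>G = \<tau> P - J\<close> with
  \<open>J x = \<integral>\<^sub>0\<^sup>x \<tau>' P\<close> has the required properties. The function \<open>Q1\<close> is merely a derivative, and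
  \<open>\<tau>'\<close> may be wild at \<open>0\<close>; both the antiderivative \<open>P\<close> and the convergence of \<open>J\<close> at \<open>0\<close> come
  from the kernel: wherever \<open>Q1 x0\<close> is nonzero, \<open>P\<close> can be taken as a multiple of \<open>Q x0\<close>, and
  \<open>\<tau>' * Q x0\<close> is integrable on \<open>[0, x0]\<close>. If \<open>Q1\<close> vanishes on the whole open interval, then \<open>Q x\<close>
  is constant and \<open>G = 0\<close> will do.
\<close>

lemma kernel_splitting:
  fixes \<tau> \<tau>' Q1 :: "real \<Rightarrow> real" and Q :: "real \<Rightarrow> real \<Rightarrow> real"
  assumes cont: "continuous_on {0..1} \<tau>" and "\<tau> 0 = 0"
    and \<tau>: "\<And>x. 0 < x \<Longrightarrow> x < 1 \<Longrightarrow> (\<tau> has_real_derivative \<tau>' x) (at x)"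
    and cont': "continuous_on {0<..<1} \<tau>'"
    and Q: "\<And>x t. x \<in> {0..1} \<Longrightarrow> t \<in> {0..1} \<Longrightarrow>
           ((\<lambda>s. Q x s) has_real_derivative - (Q1 x * Q1 t)) (at t within {0..1})"
    and int: "\<And>x. 0 < x \<Longrightarrow> x < 1 \<Longrightarrow> (\<lambda>t. \<tau>' t * Q x t) integrable_on {0..x}"
  obtains G where
    "\<And>x. 0 < x \<Longrightarrow> x < 1 \<Longrightarrow> (G has_real_derivative \<tau> x * Q1 x) (at x)"
    "(G \<longlongrightarrow> 0) (at_right 0)"
    "\<And>x. 0 < x \<Longrightarrow> x < 1 \<Longrightarrow> integral {0..x} (\<lambda>t. \<tau>' t * Q x t) = Q x x * \<tau> x + Q1 x * G x"
proof -
  have int\<tau>': "(\<tau>' has_integral \<tau> x) {0..x}" if "0 < x" "x < 1" for x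
  proof -
    have "(\<tau>' has_integral \<tau> x - \<tau> 0) {0..x}"
      by (rule fundamental_theorem_of_calculus_interior)
         (use that \<tau> in \<open>auto intro!: continuous_on_subset[OF cont]
            simp: has_real_derivative_iff_has_vector_derivative[symmetric]\<close>)
    thus ?thesis using assms(2) by simp
  qed
  have "(\<tau> \<longlongrightarrow> \<tau> 0) (at 0 within {0..1})"
    using cont unfolding continuous_on_def by simp
  hence \<tau>0: "(\<tau> \<longlongrightarrow> 0) (at_right 0)"
    using assms(2) by (simp add: at_within_Icc_at_right)
  show thesis
  proof (cases "\<exists>x0. 0 < x0 \<and> x0 < 1 \<and> Q1 x0 \<noteq> 0")
    case False
    show thesis
    proof (rule that[of "\<lambda>_. 0"])
      fix x :: real assume x: "0 < x" "x < 1"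
      show "((\<lambda>_. 0) has_real_derivative \<tau> x * Q1 x) (at x)"
        using False x by simp
      have "\<exists>c. \<forall>t\<in>{0..1}. Q x t = c"
      proof (rule has_field_derivative_zero_constant)
        show "(Q x has_field_derivative 0) (at t within {0..1})" if "t \<in> {0..1}" for t
          using Q[of x t] False x that by simp
      qed simp
      then obtain c where c: "Q x t = c" if "t \<in> {0..1}" for t
        by blast
      have "\<tau>' t * Q x x = \<tau>' t * Q x t" if "t \<in> {0..x}" for t
        using c[of t] c[of x] that x by simp
      moreover have "((\<lambda>t. \<tau>' t * Q x x) has_integral \<tau> x * Q x x) {0..x}"
        by (rule has_integral_mult_left[OF int\<tau>'[OF x]])
      ultimately have "((\<lambda>t. \<tau>' t * Q x t) has_integral \<tau> x * Q x x) {0..x}"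
        by (rule has_integral_eq)
      thus "integral {0..x} (\<lambda>t. \<tau>' t * Q x t) = Q x x * \<tau> x + Q1 x * 0"
        by (simp add: integral_unique mult.commute)
    qed simp
  next
    case True
    then obtain x0 where x0: "0 < x0" "x0 < 1" "Q1 x0 \<noteq> 0" by blast
    define P where "P t = - Q x0 t / Q1 x0" for t
    have P: "(P has_real_derivative Q1 t) (at t within {0..1})" if "t \<in> {0..1}" for t
    proof -
      have "(P has_real_derivative - (- (Q1 x0 * Q1 t)) / Q1 x0) (at t within {0..1})"
        unfolding P_def using Q[of x0 t] x0 that by (intro DERIV_cdivide DERIV_minus) auto
      thus ?thesis using x0 by simp
    qed
    have contP: "continuous_on {0..1} P"
      using P by (rule DERIV_continuous_on)
    have Q_eq: "Q x t = (Q x x + Q1 x * P x) - Q1 x * P t" if "x \<in> {0..1}" "t \<in> {0..1}" for x t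
    proof -
      have "\<exists>c. \<forall>t\<in>{0..1}. Q x t + Q1 x * P t = c"
      proof (rule has_field_derivative_zero_constant)
        show "((\<lambda>t. Q x t + Q1 x * P t) has_field_derivative 0) (at t within {0..1})" if "t \<in> {0..1}" for t
          using DERIV_add[OF Q[OF \<open>x \<in> {0..1}\<close> that] DERIV_cmult[OF P[OF that], of "Q1 x"]] by simp
      qed simp
      then obtain c where "\<And>t. t \<in> {0..1} \<Longrightarrow> Q x t + Q1 x * P t = c" by blast
      from this[OF that(1)] this[OF that(2)] show ?thesis by linarith
    qed
    have contf: "continuous_on {0<..<1} (\<lambda>t. \<tau>' t * P t)"
      by (intro continuous_intros cont' continuous_on_subset[OF contP]) auto
    have int_x0: "(\<lambda>t. \<tau>' t * P t) integrable_on {0..x0}"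
      using integrable_on_divide[OF integrable_neg[OF int[OF x0(1,2)]], of "Q1 x0"]
      by (simp add: P_def)
    have intP: "(\<lambda>t. \<tau>' t * P t) integrable_on {0..x}" if x: "0 < x" "x < 1" for x
    proof (cases "x \<le> x0")
      case True
      show ?thesis by (rule integrable_on_subinterval[OF int_x0]) (use True x in auto)
    next
      case False
      have int_x: "(\<lambda>t. \<tau>' t * P t) integrable_on {x0..x}"
        by (intro integrable_continuous_interval continuous_on_subset[OF contf]) (use x x0 in auto)
      show ?thesis
        by (rule Henstock_Kurzweil_Integration.integrable_combine[OF _ _ int_x0 int_x])
           (use False x0 in simp_all)
    qed
    define J where "J x = integral {0..x} (\<lambda>t. \<tau>' t * P t)" for x
    have J: "(J has_real_derivative \<tau>' x * P x) (at x)" if x: "0 < x" "x < 1" for x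
    proof -
      \<comment> \<open>Away from \<open>0\<close> the integrand is continuous, so the fundamental theorem applies on \<open>[a, b]\<close>.\<close>
      define a b where "a = x / 2" and "b = (x + 1) / 2"
      have ab: "0 < a" "a < x" "x < b" "b < 1" using x by (auto simp: a_def b_def)
      have "((\<lambda>y. integral {a..y} (\<lambda>t. \<tau>' t * P t)) has_real_derivative \<tau>' x * P x) (at x within {a..b})"
        by (intro integral_has_real_derivative continuous_on_subset[OF contf]) (use ab in auto)
      hence "((\<lambda>y. integral {a..y} (\<lambda>t. \<tau>' t * P t)) has_real_derivative \<tau>' x * P x) (at x)"
        using ab by (simp add: at_within_Icc_at)
      hence "((\<lambda>y. J a + integral {a..y} (\<lambda>t. \<tau>' t * P t)) has_real_derivative 0 + \<tau>' x * P x) (at x)"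
        by (intro DERIV_add DERIV_const)
      moreover have "\<forall>\<^sub>F y in nhds x. J a + integral {a..y} (\<lambda>t. \<tau>' t * P t) = J y"
      proof -
        have "\<forall>\<^sub>F y in nhds x. y \<in> {a<..<b}"
          using ab by (intro eventually_nhds_in_open) auto
        thus ?thesis
        proof eventually_elim
          case (elim y)
          thus ?case
            unfolding J_def using ab Henstock_Kurzweil_Integration.integral_combine[OF _ _ intP[of y], of a] by auto
        qed
      qed
      ultimately show ?thesis
        using DERIV_eventually_eq by fastforce
    qed
    have J0: "(J \<longlongrightarrow> 0) (at_right 0)"
    proof -
      have "continuous_on {0..1/2} J"
        unfolding J_def by (intro indefinite_integral_continuous_1 intP) auto
      hence "(J \<longlongrightarrow> J 0) (at 0 within {0..1/2})"
        unfolding continuous_on_def by auto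
      thus ?thesis by (simp add: at_within_Icc_at_right J_def)
    qed
    show thesis
    proof (rule that[of "\<lambda>x. \<tau> x * P x - J x"])
      fix x :: real assume x: "0 < x" "x < 1"
      have "(P has_real_derivative Q1 x) (at x)"
        using P[of x] x by (simp add: at_within_Icc_at)
      thus "((\<lambda>x. \<tau> x * P x - J x) has_real_derivative \<tau> x * Q1 x) (at x)"
        by (auto intro!: derivative_eq_intros \<tau>[OF x] J[OF x])
      have int: "((\<lambda>t. (Q x x + Q1 x * P x) * \<tau>' t - Q1 x * (\<tau>' t * P t)) has_integral
          (Q x x + Q1 x * P x) * \<tau> x - Q1 x * J x) {0..x}"
        unfolding J_def
        by (intro has_integral_diff has_integral_mult_right int\<tau>'[OF x] integrable_integral intP[OF x])
      have eq: "(Q x x + Q1 x * P x) * \<tau>' t - Q1 x * (\<tau>' t * P t) = \<tau>' t * Q x t" if "t \<in> {0..x}" for t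
      proof -
        have Qt: "Q x t = (Q x x + Q1 x * P x) - Q1 x * P t" using x that by (intro Q_eq) auto
        show ?thesis unfolding Qt by (simp add: algebra_simps)
      qed
      have "((\<lambda>t. \<tau>' t * Q x t) has_integral (Q x x + Q1 x * P x) * \<tau> x - Q1 x * J x) {0..x}"
        by (rule has_integral_eq[OF eq int])
      thus "integral {0..x} (\<lambda>t. \<tau>' t * Q x t) = Q x x * \<tau> x + Q1 x * (\<tau> x * P x - J x)"
        by (simp add: integral_unique algebra_simps)
    next
      have "(P \<longlongrightarrow> P 0) (at 0 within {0..1})"
        using contP unfolding continuous_on_def by auto
      hence "(P \<longlongrightarrow> P 0) (at_right 0)" by (simp add: at_within_Icc_at_right)
      hence "((\<lambda>x. \<tau> x * P x - J x) \<longlongrightarrow> 0 * P 0 - 0) (at_right 0)"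
        by (intro tendsto_intros \<tau>0 J0)
      thus "((\<lambda>x. \<tau> x * P x - J x) \<longlongrightarrow> 0) (at_right 0)" by simp
    qed
  qed
qed

section \<open>The difference of two solutions\<close>

text \<open>
  Differentiability in \<open>y\<close> at height \<open>y\<close> itself is not part of the existence of the Caputo
  derivative at that height; it comes from the one at the greater height \<open>(y + 1) / 2\<close>.
\<close>

lemma solution_in_square:
  assumes \<alpha>: "0 < \<alpha>" "\<alpha> < 1" and u: "is_solution \<alpha> \<gamma>\<^sub>1 \<gamma>\<^sub>2 \<phi>\<^sub>1 \<phi>\<^sub>2 \<psi> Q u"
  shows solution_frac_heat: "frac_heat \<alpha> 0 1 1 (\<lambda>x y. u (x, y))"
    and solution_has_partial_y: "\<And>x y. 0 < x \<Longrightarrow> x < 1 \<Longrightarrow> 0 < y \<Longrightarrow> y < 1 \<Longrightarrow>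
      ((\<lambda>t. u (x, t)) has_real_derivative partial_y u (x, y)) (at y)"
proof -
  have diff: "diff_x_at u (x, y)" "diff_x_at (partial_x u) (x, y)"
    and cap: "caputo_exists \<alpha> (\<lambda>t. u (x, t)) y"
    and eq: "partial_x (partial_x u) (x, y) = caputo \<alpha> (\<lambda>t. u (x, t)) y"
    if "0 < x" "x < 1" "0 < y" "y < 1" for x y
  proof -
    have "(x, y) \<in> Omega_plus" using that by (simp add: Omega_plus_def)
    thus "diff_x_at u (x, y)" "diff_x_at (partial_x u) (x, y)" "caputo_exists \<alpha> (\<lambda>t. u (x, t)) y"
      "partial_x (partial_x u) (x, y) = caputo \<alpha> (\<lambda>t. u (x, t)) y"
      using u unfolding is_solution_def class_W_def by auto
  qed
  show dy: "((\<lambda>t. u (x, t)) has_real_derivative partial_y u (x, y)) (at y)"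
    if "0 < x" "x < 1" "0 < y" "y < 1" for x y
  proof -
    have "(\<lambda>t. u (x, t)) differentiable at y"
      using cap[of x "(y + 1) / 2"] that unfolding caputo_exists_def by auto
    thus ?thesis by (simp add: partial_y_def DERIV_deriv_iff_real_differentiable)
  qed
  have "frac_heat_derivs \<alpha> 0 1 1 (\<lambda>x y. u (x, y)) (\<lambda>x y. partial_x u (x, y))
      (\<lambda>x y. partial_x (partial_x u) (x, y)) (\<lambda>x y. partial_y u (x, y))"
    unfolding frac_heat_derivs_def
  proof (intro allI impI conjI; elim conjE)
    fix x y :: real assume xy: "0 < x" "x < 1" "0 < y" "y < 1"
    show "((\<lambda>s. u (s, y)) has_real_derivative partial_x u (x, y)) (at x)"
      using diff(1)[OF xy] by (simp add: diff_x_at_def partial_x_def DERIV_deriv_iff_real_differentiable)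
    show "((\<lambda>s. partial_x u (s, y)) has_real_derivative partial_x (partial_x u) (x, y)) (at x)"
      using diff(2)[OF xy]
      by (simp add: diff_x_at_def partial_x_def[of "partial_x u"] DERIV_deriv_iff_real_differentiable)
    show "((\<lambda>t. u (x, t)) has_real_derivative partial_y u (x, y)) (at y)"
      by (rule dy[OF xy])
    have "Gamma (1 - \<alpha>) > 0" using \<alpha> by simp
    hence "integral {0..y} (\<lambda>t. (y - t) powr (-\<alpha>) * deriv (\<lambda>t. u (x, t)) t) =
        Gamma (1 - \<alpha>) * partial_x (partial_x u) (x, y)"
      unfolding eq[OF xy] caputo_def by simp
    moreover have "(\<lambda>t. (y - t) powr (-\<alpha>) * deriv (\<lambda>t. u (x, t)) t) integrable_on {0..y}"
      using cap[OF xy] unfolding caputo_exists_def by blast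
    ultimately show "((\<lambda>t. (y - t) powr (-\<alpha>) * partial_y u (x, t)) has_integral
        Gamma (1 - \<alpha>) * partial_x (partial_x u) (x, y)) {0..y}"
      by (simp add: partial_y_def has_integral_iff)
  qed
  thus "frac_heat \<alpha> 0 1 1 (\<lambda>x y. u (x, y))"
    unfolding frac_heat_def by blast
qed

lemma solution_dAlembert:
  assumes u: "is_solution \<alpha> \<gamma>\<^sub>1 \<gamma>\<^sub>2 \<phi>\<^sub>1 \<phi>\<^sub>2 \<psi> Q u" and xy: "(x, y) \<in> Omega_minus"
  shows "u (x, y) = u (x + y, 0) + \<psi> ((x - y) / 2) - \<psi> ((x + y) / 2)"
proof -
  have "u (x, y) = u (x + y, 0) + u ((x - y) / 2, - ((x - y) / 2)) - u ((x + y) / 2, - ((x + y) / 2))"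
    by (rule dAlembert_representation[OF _ _ _ xy])
       (use u in \<open>auto simp: is_solution_def class_W_def\<close>)
  moreover have "u (z, - z) = \<psi> z" if "0 \<le> z" "z \<le> 1/2" for z
    using u that by (auto simp: is_solution_def)
  ultimately show ?thesis
    using xy by (simp add: Omega_minus_def)
qed

lemma Omega_minus_point:
  assumes "0 < z" "z < 1"
  obtains x y where "(x, y) \<in> Omega_minus" "x + y = z"
proof (rule that)
  show "(z + (1 - z) / 4, - (1 - z) / 4) \<in> Omega_minus"
    using assms by (auto simp: Omega_minus_def field_simps)
qed (simp add: field_simps)

text \<open>
  From here on \<open>u\<close> and \<open>v\<close> are two solutions with the same data, and \<open>gap\<close> is the trace of
  \<open>v - u\<close> on the segment \<open>y = 0\<close>.
\<close>

context
  fixes \<alpha> \<gamma>\<^sub>1 \<gamma>\<^sub>2 :: real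
    and \<phi>\<^sub>1 \<phi>\<^sub>2 \<psi> :: "real \<Rightarrow> real"
    and Q :: "real \<Rightarrow> real \<Rightarrow> real"
    and u v :: "real \<times> real \<Rightarrow> real"
  assumes u: "is_solution \<alpha> \<gamma>\<^sub>1 \<gamma>\<^sub>2 \<phi>\<^sub>1 \<phi>\<^sub>2 \<psi> Q u"
    and v: "is_solution \<alpha> \<gamma>\<^sub>1 \<gamma>\<^sub>2 \<phi>\<^sub>1 \<phi>\<^sub>2 \<psi> Q v"
begin

abbreviation "gap z \<equiv> v (z, 0) - u (z, 0)"
abbreviation "gap' z \<equiv> deriv (\<lambda>z. v (z, 0) - u (z, 0)) z"

text \<open>
  In d'Alembert's formula the common values \<open>\<psi>\<close> on the left characteristic cancel.
\<close>

lemma difference_in_triangle: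
  assumes "(x, y) \<in> Omega_minus"
  shows "v (x, y) - u (x, y) = gap (x + y)"
  using solution_dAlembert[OF u assms] solution_dAlembert[OF v assms] by simp

text \<open>
  Regularity of the trace is read off inside the triangle, where \<open>v - u\<close> is a function of
  \<open>x + y\<close> alone: on a vertical line it is a translate of \<open>gap\<close>.
\<close>

lemma gap_derivative:
  assumes "(x, y) \<in> Omega_minus"
  shows "((\<lambda>z. gap z) has_real_derivative
     partial_y v (x, y) - partial_y u (x, y)) (at (x + y))"
proof -
  have C1: "C1_on u Omega_minus" "C1_on v Omega_minus"
    using u v by (auto simp: is_solution_def class_W_def C2_on_def)
  have "((\<lambda>s. v (x, s) - u (x, s)) has_real_derivative partial_y v (x, y) - partial_y u (x, y)) (at y)"
    by (intro DERIV_diff C1_onD(2)[OF C1(1) assms] C1_onD(2)[OF C1(2) assms])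
  moreover have "\<forall>\<^sub>F s in nhds y. v (x, s) - u (x, s) = gap (s + x)"
  proof -
    have "\<forall>\<^sub>F s in nhds y. s \<in> {s. - s < x} \<inter> {s. x < s + 1} \<inter> {- (1/2)<..<0}"
      using assms
      by (intro eventually_nhds_in_open open_Int open_Collect_less continuous_intros)
         (auto simp: Omega_minus_def)
    thus ?thesis
    proof eventually_elim
      case (elim s)
      hence "(x, s) \<in> Omega_minus" by (simp add: Omega_minus_def)
      from difference_in_triangle[OF this] show ?case by (simp add: add.commute)
    qed
  qed
  ultimately have "((\<lambda>s. gap (s + x)) has_real_derivative
      partial_y v (x, y) - partial_y u (x, y)) (at y)"
    by (rule DERIV_eventually_eq)
  thus ?thesis
    using DERIV_shift[of "\<lambda>z. gap z" _ y x] by (simp add: add.commute)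
qed

lemma gap'_eq:
  assumes "(x, y) \<in> Omega_minus"
  shows "gap' (x + y) = partial_y v (x, y) - partial_y u (x, y)"
  using gap_derivative[OF assms] by (rule DERIV_imp_deriv)

lemma gap_has_derivative:
  assumes "0 < z" "z < 1"
  shows "((\<lambda>z. gap z) has_real_derivative gap' z) (at z)"
proof -
  obtain x y where xy: "(x, y) \<in> Omega_minus" "x + y = z"
    by (rule Omega_minus_point[OF assms])
  show ?thesis
    using gap_derivative[OF xy(1)] gap'_eq[OF xy(1)] xy(2) by simp
qed

lemma gap'_differentiable:
  assumes "0 < z" "z < 1"
  shows "(\<lambda>z. gap' z) differentiable at z"
proof -
  obtain x y where xy: "(x, y) \<in> Omega_minus" "x + y = z"
    by (rule Omega_minus_point[OF assms])
  have C1: "C1_on (partial_y u) Omega_minus" "C1_on (partial_y v) Omega_minus"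
    using u v by (auto simp: is_solution_def class_W_def C2_on_def)
  let ?l = "partial_y (partial_y v) (x, y) - partial_y (partial_y u) (x, y)"
  have "((\<lambda>s. partial_y v (x, s) - partial_y u (x, s)) has_real_derivative ?l) (at y)"
    by (intro DERIV_diff C1_onD(2)[OF C1(1) xy(1)] C1_onD(2)[OF C1(2) xy(1)])
  moreover have "\<forall>\<^sub>F s in nhds y. partial_y v (x, s) - partial_y u (x, s) = gap' (s + x)"
  proof -
    have "\<forall>\<^sub>F s in nhds y. s \<in> {s. - s < x} \<inter> {s. x < s + 1} \<inter> {- (1/2)<..<0}"
      using xy(1)
      by (intro eventually_nhds_in_open open_Int open_Collect_less continuous_intros)
         (auto simp: Omega_minus_def)
    thus ?thesis
    proof eventually_elim
      case (elim s)
      hence "(x, s) \<in> Omega_minus" by (simp add: Omega_minus_def)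
      from gap'_eq[OF this] show ?case by (simp add: add.commute)
    qed
  qed
  ultimately have "((\<lambda>s. gap' (s + x)) has_real_derivative ?l) (at y)"
    by (rule DERIV_eventually_eq)
  hence "((\<lambda>z. gap' z) has_real_derivative ?l) (at (y + x))"
    using DERIV_shift[of "\<lambda>z. gap' z" _ y x] by simp
  thus ?thesis
    using xy(2) by (metis add.commute real_differentiable_def)
qed

lemma gap'_eq_uy_minus:
  assumes "0 < x" "x < 1"
  shows "gap' x = uy_minus v x - uy_minus u x"
proof -
  have lim: "((\<lambda>y. partial_y v (x, y) - partial_y u (x, y)) \<longlongrightarrow> uy_minus v x - uy_minus u x) (at_left 0)"
    using u v assms by (intro tendsto_diff) (auto simp: is_solution_def gluing_def)
  have "isCont (\<lambda>z. gap' z) x"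
    using gap'_differentiable[OF assms] by (rule differentiable_imp_continuous_within)
  hence "((\<lambda>y. gap' (x + y)) \<longlongrightarrow> gap' x) (at 0)"
    unfolding isCont_def by (rule LIM_offset_zero)
  hence "((\<lambda>y. gap' (x + y)) \<longlongrightarrow> gap' x) (at_left 0)"
    by (rule tendsto_mono[OF at_le[OF subset_UNIV]])
  moreover have "\<forall>\<^sub>F y in at_left 0. gap' (x + y) = partial_y v (x, y) - partial_y u (x, y)"
  proof -
    define m where "m = max (- x) (max (x - 1) (- (1/2)))"
    have "m < 0" using assms by (auto simp: m_def)
    from eventually_at_left_real[OF this] show ?thesis
    proof eventually_elim
      case (elim y)
      hence "(x, y) \<in> Omega_minus" by (auto simp: Omega_minus_def m_def)
      thus ?case by (rule gap'_eq)
    qed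
  qed
  ultimately have "((\<lambda>y. partial_y v (x, y) - partial_y u (x, y)) \<longlongrightarrow> gap' x) (at_left 0)"
    by (rule Lim_transform_eventually)
  from tendsto_unique[OF _ this lim] show ?thesis by simp
qed

lemma difference_gluing:
  assumes x: "0 < x" "x < 1"
  shows "(\<lambda>t. gap' t * Q x t) integrable_on {0..x}"
    and "((\<lambda>y. y powr (1 - \<alpha>) * (partial_y v (x, y) - partial_y u (x, y))) \<longlongrightarrow>
       \<gamma>\<^sub>1 * gap' x + \<gamma>\<^sub>2 * integral {0..x} (\<lambda>t. gap' t * Q x t)) (at_right 0)"
proof -
  have iu: "(\<lambda>t. uy_minus u t * Q x t) integrable_on {0..x}"
    and iv: "(\<lambda>t. uy_minus v t * Q x t) integrable_on {0..x}"
    using u v x by (auto simp: is_solution_def gluing_def)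
  have lu: "((\<lambda>y. y powr (1 - \<alpha>) * partial_y u (x, y)) \<longlongrightarrow>
      \<gamma>\<^sub>1 * uy_minus u x + \<gamma>\<^sub>2 * integral {0..x} (\<lambda>t. uy_minus u t * Q x t)) (at_right 0)"
    and lv: "((\<lambda>y. y powr (1 - \<alpha>) * partial_y v (x, y)) \<longlongrightarrow>
      \<gamma>\<^sub>1 * uy_minus v x + \<gamma>\<^sub>2 * integral {0..x} (\<lambda>t. uy_minus v t * Q x t)) (at_right 0)"
    using u v x by (auto simp: is_solution_def gluing_def)
  have int: "((\<lambda>t. gap' t * Q x t) has_integral
      integral {0..x} (\<lambda>t. uy_minus v t * Q x t) - integral {0..x} (\<lambda>t. uy_minus u t * Q x t)) {0..x}"
  proof (rule has_integral_spike_finite[OF _ _ has_integral_diff[OF integrable_integral[OF iv] integrable_integral[OF iu]]])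
    fix t assume "t \<in> {0..x} - {0}"
    hence "0 < t" "t < 1" using x by auto
    from gap'_eq_uy_minus[OF this]
    show "gap' t * Q x t = uy_minus v t * Q x t - uy_minus u t * Q x t"
      by (simp add: left_diff_distrib)
  qed simp
  show "(\<lambda>t. gap' t * Q x t) integrable_on {0..x}" using int by blast
  show "((\<lambda>y. y powr (1 - \<alpha>) * (partial_y v (x, y) - partial_y u (x, y))) \<longlongrightarrow>
       \<gamma>\<^sub>1 * gap' x + \<gamma>\<^sub>2 * integral {0..x} (\<lambda>t. gap' t * Q x t)) (at_right 0)"
  proof -
    have "\<gamma>\<^sub>1 * gap' x + \<gamma>\<^sub>2 * integral {0..x} (\<lambda>t. gap' t * Q x t) =
        (\<gamma>\<^sub>1 * uy_minus v x + \<gamma>\<^sub>2 * integral {0..x} (\<lambda>t. uy_minus v t * Q x t)) -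
        (\<gamma>\<^sub>1 * uy_minus u x + \<gamma>\<^sub>2 * integral {0..x} (\<lambda>t. uy_minus u t * Q x t))"
      unfolding gap'_eq_uy_minus[OF x] integral_unique[OF int] by (simp add: algebra_simps)
    thus ?thesis
      using tendsto_diff[OF lv lu] by (simp only: right_diff_distrib)
  qed
qed

lemma difference_continuous:
  "continuous_on ({0..1} \<times> {0..1}) (\<lambda>(x, y). v (x, y) - u (x, y))"
proof -
  have "continuous_on (closure Omega) (\<lambda>p. v p - u p)"
    using u v by (intro continuous_on_diff) (auto simp: is_solution_def class_W_def)
  hence "continuous_on ({0..1} \<times> {0..1}) (\<lambda>p. v p - u p)"
    by (rule continuous_on_subset) (auto intro: square_in_closure)
  thus ?thesis by (simp add: case_prod_beta)
qed

lemma difference_frac_heat: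
  assumes \<alpha>: "0 < \<alpha>" "\<alpha> < 1"
  shows "frac_heat \<alpha> 0 1 1 (\<lambda>x y. v (x, y) - u (x, y))"
  by (intro frac_heat_diff solution_frac_heat[OF \<alpha> u] solution_frac_heat[OF \<alpha> v])

text \<open>
  The short-time rate of \<open>v - u\<close> at \<open>(x, 0)\<close> is \<open>gap'' x / \<Gamma> (1 + \<alpha>)\<close> by the equation and
  \<open>\<nu> x / \<alpha>\<close> by the gluing condition, with \<open>\<nu> x\<close> the limit in \<open>difference_gluing\<close>; moreover \<open>\<Gamma> (1 + \<alpha>) = \<alpha> \<Gamma> \<alpha>\<close>.
\<close>

lemma gap_equation:
  assumes \<alpha>: "0 < \<alpha>" "\<alpha> < 1" and x: "0 < x" "x < 1"
  shows "((\<lambda>z. gap' z) has_real_derivative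
    Gamma \<alpha> * (\<gamma>\<^sub>1 * gap' x + \<gamma>\<^sub>2 * integral {0..x} (\<lambda>t. gap' t * Q x t))) (at x)"
proof -
  let ?\<nu> = "\<gamma>\<^sub>1 * gap' x + \<gamma>\<^sub>2 * integral {0..x} (\<lambda>t. gap' t * Q x t)"
  obtain l where l: "((\<lambda>z. gap' z) has_real_derivative l) (at x)"
    using gap'_differentiable[OF x] real_differentiable_def by blast
  have "((\<lambda>y. (v (x, y) - u (x, y) - gap x) / y powr \<alpha>) \<longlongrightarrow> l / Gamma (1 + \<alpha>)) (at_right 0)"
    by (rule frac_heat_initial_rate[OF \<alpha> difference_frac_heat[OF \<alpha>] difference_continuous x gap_has_derivative l])
  moreover have "((\<lambda>y. (v (x, y) - u (x, y) - gap x) / y powr \<alpha>) \<longlongrightarrow> ?\<nu> / \<alpha>) (at_right 0)"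
  proof (rule powr_rate_lhopital[OF \<alpha>(1) _ _ difference_gluing(2)[OF x]])
    have "continuous_on {0..1} ((\<lambda>(x, y). v (x, y) - u (x, y)) \<circ> (\<lambda>y. (x, y)))"
      by (intro continuous_on_compose continuous_intros continuous_on_subset[OF difference_continuous])
         (use x in auto)
    hence "((\<lambda>y. v (x, y) - u (x, y)) \<longlongrightarrow> gap x) (at 0 within {0..1})"
      unfolding continuous_on_def o_def by simp
    thus "((\<lambda>y. v (x, y) - u (x, y)) \<longlongrightarrow> gap x) (at_right 0)"
      by (simp add: at_within_Icc_at_right)
    have "\<forall>\<^sub>F y::real in at_right 0. y \<in> {0<..<1}"
      by (rule eventually_at_right_real) simp
    thus "\<forall>\<^sub>F y in at_right 0. ((\<lambda>y. v (x, y) - u (x, y)) has_real_derivative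
        partial_y v (x, y) - partial_y u (x, y)) (at y)"
    proof eventually_elim
      case (elim y)
      thus ?case
        by (intro DERIV_diff solution_has_partial_y[OF \<alpha> u x] solution_has_partial_y[OF \<alpha> v x]) auto
    qed
  qed
  ultimately have "l / Gamma (1 + \<alpha>) = ?\<nu> / \<alpha>"
    by (rule tendsto_unique[OF trivial_limit_at_right_real])
  moreover have "Gamma (1 + \<alpha>) = \<alpha> * Gamma \<alpha>"
  proof -
    have "\<alpha> \<notin> \<int>\<^sub>\<le>\<^sub>0" using \<alpha> nonpos_Ints_nonpos[of \<alpha>] by linarith
    thus ?thesis using Gamma_plus1[of \<alpha>] by (simp add: add.commute)
  qed
  moreover have "Gamma \<alpha> > 0" using \<alpha> by simp
  ultimately have "l = Gamma \<alpha> * ?\<nu>"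
    using \<alpha> by (simp add: field_simps)
  thus ?thesis using l by simp
qed

lemma difference_boundary:
  shows "y \<in> {0..1} \<Longrightarrow> v (0, y) - u (0, y) = 0" "y \<in> {0..1} \<Longrightarrow> v (1, y) - u (1, y) = 0"
  using u v by (auto simp: is_solution_def)

lemma gap_vanishes:
  assumes \<alpha>: "0 < \<alpha>" "\<alpha> < 1" and "0 \<le> \<gamma>\<^sub>2"
    and Q: "\<And>x t. x \<in> {0..1} \<Longrightarrow> t \<in> {0..1} \<Longrightarrow>
           ((\<lambda>s. Q x s) has_real_derivative - (Q\<^sub>1 x * Q\<^sub>1 t)) (at t within {0..1})"
    and Qpos: "\<And>x. x \<in> {0..1} \<Longrightarrow> Q x x > 0"
    and x: "0 \<le> x" "x \<le> 1"
  shows "gap x = 0"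
proof -
  have "continuous_on {0..1} ((\<lambda>(x, y). v (x, y) - u (x, y)) \<circ> (\<lambda>x. (x, 0)))"
    by (intro continuous_on_compose continuous_intros continuous_on_subset[OF difference_continuous]) auto
  hence cont: "continuous_on {0..1} (\<lambda>z. gap z)" by (simp add: o_def)
  have ends: "gap 0 = 0" "gap 1 = 0"
    using difference_boundary[of 0] by auto
  have cont': "continuous_on {0<..<1} (\<lambda>z. gap' z)"
    by (intro differentiable_imp_continuous_on differentiable_at_imp_differentiable_on)
       (auto intro: gap'_differentiable)
  obtain G where G:
    "\<And>x. 0 < x \<Longrightarrow> x < 1 \<Longrightarrow> (G has_real_derivative gap x * Q\<^sub>1 x) (at x)"
    "(G \<longlongrightarrow> 0) (at_right 0)"
    "\<And>x. 0 < x \<Longrightarrow> x < 1 \<Longrightarrow>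
       integral {0..x} (\<lambda>t. gap' t * Q x t) = Q x x * gap x + Q\<^sub>1 x * G x"
    by (rule kernel_splitting[OF cont ends(1) gap_has_derivative cont' Q difference_gluing(1)]) blast+
  show ?thesis
  proof (rule nonlocal_problem_trivial[OF cont ends gap_has_derivative _ G(1,2) _ _ x])
    fix z :: real assume z: "0 < z" "z < 1"
    have "Gamma \<alpha> * (\<gamma>\<^sub>1 * gap' z + \<gamma>\<^sub>2 * integral {0..z} (\<lambda>t. gap' t * Q z t)) =
        (Gamma \<alpha> * \<gamma>\<^sub>1) * gap' z + (Gamma \<alpha> * \<gamma>\<^sub>2) * (Q z z * gap z + Q\<^sub>1 z * G z)"
      unfolding G(3)[OF z] by (simp only: distrib_left mult.assoc)
    thus "((\<lambda>z. gap' z) has_real_derivative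
        (Gamma \<alpha> * \<gamma>\<^sub>1) * gap' z + (Gamma \<alpha> * \<gamma>\<^sub>2) * (Q z z * gap z + Q\<^sub>1 z * G z)) (at z)"
      using gap_equation[OF \<alpha> z] by simp
    show "0 < Q z z" using z by (intro Qpos) auto
  next
    have "Gamma \<alpha> > 0" using \<alpha> by simp
    thus "0 \<le> Gamma \<alpha> * \<gamma>\<^sub>2" using \<open>0 \<le> \<gamma>\<^sub>2\<close> by simp
  qed
qed

end

section \<open>Uniqueness\<close>

lemma solutions_le:
  assumes \<alpha>: "0 < \<alpha>" "\<alpha> < 1" and "0 \<le> \<gamma>\<^sub>2"
    and u: "is_solution \<alpha> \<gamma>\<^sub>1 \<gamma>\<^sub>2 \<phi>\<^sub>1 \<phi>\<^sub>2 \<psi> Q u"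
    and v: "is_solution \<alpha> \<gamma>\<^sub>1 \<gamma>\<^sub>2 \<phi>\<^sub>1 \<phi>\<^sub>2 \<psi> Q v"
    and Q: "\<And>x t. x \<in> {0..1} \<Longrightarrow> t \<in> {0..1} \<Longrightarrow>
           ((\<lambda>s. Q x s) has_real_derivative - (Q\<^sub>1 x * Q\<^sub>1 t)) (at t within {0..1})"
    and Qpos: "\<And>x. x \<in> {0..1} \<Longrightarrow> Q x x > 0"
    and p: "p \<in> Omega"
  shows "v p \<le> u p"
proof -
  obtain x y where xy: "p = (x, y)" by force
  note gap0 = gap_vanishes[OF u v \<alpha> \<open>0 \<le> \<gamma>\<^sub>2\<close> Q Qpos]
  consider "(x, y) \<in> Omega_minus" | "0 < x" "x < 1" "0 \<le> y" "y < 1"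
    using p xy by (auto simp: Omega_def Omega_plus_def seg_AB_def)
  thus ?thesis
  proof cases
    case 1
    have "0 \<le> x + y" "x + y \<le> 1" using 1 by (auto simp: Omega_minus_def)
    thus ?thesis
      using difference_in_triangle[OF u v 1] gap0[of "x + y"] xy by simp
  next
    case 2
    have "v (x, y) - u (x, y) \<le> 0"
    proof (rule frac_heat_comparison[OF \<alpha> difference_frac_heat[OF u v \<alpha>] \<open>y < 1\<close>])
      show "continuous_on ({0..1} \<times> {0..y}) (\<lambda>(x, y). v (x, y) - u (x, y))"
        by (rule continuous_on_subset[OF difference_continuous[OF u v]]) (use 2 in auto)
    qed (use 2 gap0 difference_boundary[OF u v] in \<open>simp_all\<close>)
    thus ?thesis using xy by simp
  qed
qed

theorem theorem1:
  fixes \<alpha> \<gamma>\<^sub>1 \<gamma>\<^sub>2 :: real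
    and \<phi>\<^sub>1 \<phi>\<^sub>2 \<psi> Q\<^sub>1 :: "real \<Rightarrow> real"
    and Q :: "real \<Rightarrow> real \<Rightarrow> real"
  assumes "0 < \<alpha>" and "\<alpha> < 1"
    and "\<gamma>\<^sub>1\<^sup>2 + \<gamma>\<^sub>2\<^sup>2 \<noteq> 0"
    and "\<phi>\<^sub>1 0 = \<psi> 0"
    and "\<gamma>\<^sub>2 \<ge> 0"
    and "\<And>x t. x \<in> {0..1} \<Longrightarrow> t \<in> {0..1} \<Longrightarrow>
           ((\<lambda>s. Q x s) has_real_derivative - (Q\<^sub>1 x * Q\<^sub>1 t)) (at t within {0..1})"
    and "\<And>x. x \<in> {0..1} \<Longrightarrow> Q x x > 0"
    and "\<exists>u. is_solution \<alpha> \<gamma>\<^sub>1 \<gamma>\<^sub>2 \<phi>\<^sub>1 \<phi>\<^sub>2 \<psi> Q u"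
  shows "\<exists>u. is_solution \<alpha> \<gamma>\<^sub>1 \<gamma>\<^sub>2 \<phi>\<^sub>1 \<phi>\<^sub>2 \<psi> Q u \<and>
           (\<forall>v. is_solution \<alpha> \<gamma>\<^sub>1 \<gamma>\<^sub>2 \<phi>\<^sub>1 \<phi>\<^sub>2 \<psi> Q v \<longrightarrow> (\<forall>p\<in>closure Omega. v p = u p))"
proof -
  obtain u where u: "is_solution \<alpha> \<gamma>\<^sub>1 \<gamma>\<^sub>2 \<phi>\<^sub>1 \<phi>\<^sub>2 \<psi> Q u"
    using assms(8) by blast
  have "v p = u p" if v: "is_solution \<alpha> \<gamma>\<^sub>1 \<gamma>\<^sub>2 \<phi>\<^sub>1 \<phi>\<^sub>2 \<psi> Q v" and p: "p \<in> closure Omega" for v p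
  proof -
    have eq: "v q - u q = 0" if "q \<in> Omega" for q
      using solutions_le[OF assms(1,2,5) u v assms(6,7) that]
        solutions_le[OF assms(1,2,5) v u assms(6,7) that] by simp
    have "continuous_on (closure Omega) (\<lambda>q. v q - u q)"
      using u v by (intro continuous_on_diff) (auto simp: is_solution_def class_W_def)
    from continuous_constant_on_closure[OF this eq p] show ?thesis by simp
  qed
  thus ?thesis using u by blast
qed

end
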